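(* Let $\rho_0:[0,1]\to[0,1]$ be a measurable profile and let $(\mu_N)_N$ be a sequence of probability measures on $\Omega_N$ associated to $\rho_0$. Then for any $t\in(0,T]$, any $\delta>0$ and any continuous function $H:[0,1]\to\mathbb{R}$, $$\lim_{N\to\infty}\tilde{\mathbb{P}}_{\mu_N}\Big[\,\Big|\langle \pi^N_t,H\rangle - m(t)\int_0^1 H(x)\,dx\Big|>\delta\Big]=0,$$ where $m:[0,T]\to[0,1]$ is the unique solution of $\partial_t m=-2(m-\gamma)$ with $m(0)=\int_0^1\rho_0(x)\,dx$.
   Context: Fix $T>0$, $0<\alpha,\beta<1$, and set $\gamma=(\alpha+\beta)/2$. For $N\ge 3$ let $\Sigma_N=\{1,\dots,N-1\}$, $\Omega_N=\{0,1\}^{\Sigma_N}$, $r_1=\alpha$, $r_{N-1}=\beta$. For $f:\Omega_N\to\mathbb{R}$ define $(\mathcal{L}_{N,0}f)(\eta)=\sum_{x=1}^{N-2}(f(\eta^{x,x+1})-f(\eta))$ and $(\mathcal{L}_{N,b}f)(\eta)=\sum_{x\in\{1,N-1\}}[r_x(1-\eta(x))+(1-r_x)\eta(x)](f(\eta^x)-f(\eta))$, where $\eta^{x,x+1}$ is obtained from $\eta$ by exchanging the values at $x$ and $x+1$, and $\eta^x$ by replacing $\eta(x)$ with $1-\eta(x)$. The accelerated process $(\zeta_t)_{t\in[0,T]}$ is the continuous-time Markov process on $\Omega_N$ with generator $N^3\mathcal{L}_{N,0}+N\mathcal{L}_{N,b}$; $\tilde{\mathbb{P}}_{\mu_N}$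 is its law on the space of right-continuous, left-limited trajectories $[0,T]\to\Omega_N$ when $\zeta_0$ has law $\mu_N$. For $\eta\in\Omega_N$ the empirical measure is $\pi^N(\eta)=\frac1N\sum_{x=1}^{N-1}\eta(x)\delta_{x/N}$; $\pi^N_t=\pi^N(\zeta_t)$; and $\langle\pi^N,F\rangle=\frac1N\sum_{x=1}^{N-1}\eta(x)F(x/N)$. A sequence $(\mu_N)$ is associated to $\rho_0$ if for every $\delta>0$ and every continuous $G:[0,1]\to\mathbb{R}$, $\lim_{N\to\infty}\mu_N[|\langle\pi^N,G\rangle-\int_0^1\rho_0(x)G(x)dx|>\delta]=0$. *)

theory Defs
  imports "HOL-Probability.Probability"
begin

section \<open>Continuous-time Markov processes on a finite state space\<close>

text \<open>
  Trajectories are extensional functions on \<open>{0..T}\<close>.  In the application the state space is a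
  finite set of configurations, on which the product topology of \<open>nat \<Rightarrow> nat\<close> is discrete.
\<close>

definition cadlag_paths :: "real \<Rightarrow> 's::topological_space set \<Rightarrow> (real \<Rightarrow> 's) set" where
  "cadlag_paths T E = {\<omega> \<in> {0..T} \<rightarrow>\<^sub>E E.
     (\<forall>t\<in>{0..<T}. (\<omega> \<longlongrightarrow> \<omega> t) (at_right t)) \<and>
     (\<forall>t\<in>{0<..T}. \<exists>l\<in>E. (\<omega> \<longlongrightarrow> l) (at_left t))}"

text \<open>The \<open>\<sigma>\<close>-algebra is the one generated by the coordinates \<open>\<omega> \<mapsto> \<omega> t\<close>.\<close>

definition path_space :: "real \<Rightarrow> 's::topological_space set \<Rightarrow> (real \<Rightarrow> 's) measure" where
  "path_space T E = restrict_space (Pi\<^sub>M {0..T} (\<lambda>_. count_space E)) (cadlag_paths T E)"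

definition past :: "real \<Rightarrow> 's::topological_space set \<Rightarrow> real \<Rightarrow> (real \<Rightarrow> 's) measure" where
  "past T E s = vimage_algebra (cadlag_paths T E) (\<lambda>\<omega>. restrict \<omega> {0..s})
     (Pi\<^sub>M {0..s} (\<lambda>_. count_space E))"

definition transition_semigroup :: "'s set \<Rightarrow> (real \<Rightarrow> 's \<Rightarrow> 's pmf) \<Rightarrow> bool" where
  "transition_semigroup E K \<longleftrightarrow>
     (\<forall>t\<ge>0. \<forall>x\<in>E. set_pmf (K t x) \<subseteq> E) \<and>
     (\<forall>x\<in>E. K 0 x = return_pmf x) \<and>
     (\<forall>s\<ge>0. \<forall>t\<ge>0. \<forall>x\<in>E. K (s + t) x = bind_pmf (K s x) (K t))"

text \<open>
  Every real function on a finite \<open>E\<close> is in the domain of the generator, so \<open>f\<close> is arbitrary.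
\<close>

definition has_generator ::
  "'s set \<Rightarrow> (real \<Rightarrow> 's \<Rightarrow> 's pmf) \<Rightarrow> (('s \<Rightarrow> real) \<Rightarrow> 's \<Rightarrow> real) \<Rightarrow> bool" where
  "has_generator E K L \<longleftrightarrow>
     (\<forall>f. \<forall>x\<in>E. ((\<lambda>h. (measure_pmf.expectation (K h x) f - f x) / h) \<longlongrightarrow> L f x) (at_right 0))"

text \<open>
  \<open>P\<close> is the law on path space of the Markov process with generator \<open>L\<close> and initial law \<open>\<mu>\<close>.
\<close>

definition markov_law ::
  "real \<Rightarrow> 's::topological_space set \<Rightarrow> (('s \<Rightarrow> real) \<Rightarrow> 's \<Rightarrow> real) \<Rightarrow> 's pmf
     \<Rightarrow> (real \<Rightarrow> 's) measure \<Rightarrow> bool" where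
  "markov_law T E L \<mu> P \<longleftrightarrow>
     prob_space P \<and>
     sets P = sets (path_space T E) \<and>
     distr P (count_space UNIV) (\<lambda>\<omega>. \<omega> 0) = measure_pmf \<mu> \<and>
     (\<exists>K. transition_semigroup E K \<and> has_generator E K L \<and>
        (\<forall>f s t. 0 \<le> s \<and> s \<le> t \<and> t \<le> T \<longrightarrow>
           (AE \<omega> in P. real_cond_exp P (past T E s) (\<lambda>\<omega>'. f (\<omega>' t)) \<omega>
                       = measure_pmf.expectation (K (t - s) (\<omega> s)) f)))"


section \<open>The accelerated exclusion process with boundary reservoirs\<close>

type_synonym config = "nat \<Rightarrow> nat"

definition configs :: "nat \<Rightarrow> config set" where
  "configs N = {1..N - 1} \<rightarrow>\<^sub>E {0, 1}"

definition exchange :: "config \<Rightarrow> nat \<Rightarrow> config" where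
  "exchange \<eta> x = \<eta>(x := \<eta> (x + 1), x + 1 := \<eta> x)"

definition flip :: "config \<Rightarrow> nat \<Rightarrow> config" where
  "flip \<eta> x = \<eta>(x := 1 - \<eta> x)"

definition bulk_generator :: "nat \<Rightarrow> (config \<Rightarrow> real) \<Rightarrow> config \<Rightarrow> real" where
  "bulk_generator N f \<eta> = (\<Sum>x = 1..N - 2. f (exchange \<eta> x) - f \<eta>)"

text \<open>Only the values at \<open>1\<close> and \<open>N - 1\<close> matter; these are distinct for \<open>N \<ge> 3\<close>.\<close>

definition reservoir :: "real \<Rightarrow> real \<Rightarrow> nat \<Rightarrow> real" where
  "reservoir \<alpha> \<beta> x = (if x = 1 then \<alpha> else \<beta>)"

definition boundary_generator ::
  "real \<Rightarrow> real \<Rightarrow> nat \<Rightarrow> (config \<Rightarrow> real) \<Rightarrow> config \<Rightarrow> real" where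
  "boundary_generator \<alpha> \<beta> N f \<eta> =
     (\<Sum>x \<in> {1, N - 1}.
        (reservoir \<alpha> \<beta> x * (1 - real (\<eta> x)) + (1 - reservoir \<alpha> \<beta> x) * real (\<eta> x))
        * (f (flip \<eta> x) - f \<eta>))"

definition accelerated_generator ::
  "real \<Rightarrow> real \<Rightarrow> nat \<Rightarrow> (config \<Rightarrow> real) \<Rightarrow> config \<Rightarrow> real" where
  "accelerated_generator \<alpha> \<beta> N f \<eta> =
     real N ^ 3 * bulk_generator N f \<eta> + real N * boundary_generator \<alpha> \<beta> N f \<eta>"

text \<open>
  The integral of \<open>F\<close> against the empirical measure, which has mass \<open>\<eta> x / N\<close> at each \<open>x / N\<close>.
\<close>

definition empirical :: "nat \<Rightarrow> config \<Rightarrow> (real \<Rightarrow> real) \<Rightarrow> real" where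
  "empirical N \<eta> F = (\<Sum>x = 1..N - 1. real (\<eta> x) * F (real x / real N)) / real N"

definition associated :: "(nat \<Rightarrow> config pmf) \<Rightarrow> (real \<Rightarrow> real) \<Rightarrow> bool" where
  "associated \<mu> \<rho>0 \<longleftrightarrow>
     (\<forall>\<delta>>0. \<forall>G. continuous_on {0..1} G \<longrightarrow>
        (\<lambda>N. measure_pmf.prob (\<mu> N)
           {\<eta>. \<bar>empirical N \<eta> G - (LINT x|lebesgue_on {0..1}. \<rho>0 x * G x)\<bar> > \<delta>})
        \<longlonglongrightarrow> 0)"

text \<open>Extensionality outside \<open>{0..T}\<close> makes uniqueness of the solution meaningful.\<close>

definition mass_solution :: "real \<Rightarrow> real \<Rightarrow> real \<Rightarrow> (real \<Rightarrow> real) \<Rightarrow> bool" where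
  "mass_solution T \<gamma> m\<^sub>0 m \<longleftrightarrow>
     m \<in> {0..T} \<rightarrow>\<^sub>E {0..1} \<and>
     (\<forall>t\<in>{0..T}. (m has_real_derivative - 2 * (m t - \<gamma>)) (at t within {0..T})) \<and>
     m 0 = m\<^sub>0"

end

theory Submission
  imports Defs
begin

text \<open>
  Only linear statistics \<open>F \<eta> = (1 / N) \<Sum>x. g x * \<eta> x\<close> and their squares are needed: the exclusion
  generator closes on the former, and \<open>L (F - c)\<^sup>2 = 2 (F - c) L F + \<Gamma> F\<close> with an explicit carre du
  champ \<open>\<Gamma> F\<close>.  For a small correction of the total mass, \<open>L F = - 2 (F - \<gamma>) + O(1 / N)\<close> pointwise
  and \<open>\<Gamma> F = O(1 / N)\<close>, so Gronwall shows that the mass concentrates on the solution of the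
  differential equation.  For \<open>g\<close> a nonconstant discrete Neumann cosine, \<open>F\<close> relaxes at a rate of
  order \<open>N\<close> while \<open>\<Gamma> F\<close> and the boundary terms stay bounded, so \<open>F\<close> vanishes in \<open>L\<^sup>2\<close> at every positive
  time.  Cosine polynomials are dense in the continuous functions on \<open>{0..1}\<close>.
\<close>

text \<open>The unweighted mass has drift
  \<open>\<alpha> + \<beta> - \<eta> 1 - \<eta> (N - 1)\<close>, which is not a function of the
  mass; the obstacle is to replace two boundary occupation numbers by the mean density. No
  local-equilibrium argument is used: on linear statistics the bulk dynamics acts through
  \<open>N ^ 2\<close> times the discrete Laplacian of the weight, so a weight whose Laplacian has
  order \<open>N ^ -3\<close> moves an amount of order 1 of drift from the two ends to all sites,
  and such a weight differs from 1 by only O(1 / N). Diffusion over N sites needs speed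
  \<open>N ^ 2\<close>; the spare factor N in \<open>N ^ 3\<close> is what makes this correction
  small and the cosine modes fast. The rate 2 of the limit equation counts the two reservoirs, each
  contributing its parameter minus the density. Since the claim concerns one fixed time, all
  estimates are second moments under the kernel \<open>K t x\<close> from a fixed configuration,
  averaged over the initial law afterwards. Strict positivity of t matters: a nonconstant initial
  profile has nonzero cosine modes, and these vanish only after the relaxation.\<close>

section \<open>Expectations under a finite-state Markov semigroup\<close>

lemma pmf_expectation_mono:
  fixes f g :: "'a \<Rightarrow> real"
  assumes "finite (set_pmf p)" "\<And>x. x \<in> set_pmf p \<Longrightarrow> f x \<le> g x"
  shows "measure_pmf.expectation p f \<le> measure_pmf.expectation p g"
  by (intro integral_mono_AE integrable_measure_pmf_finite AE_pmfI assms)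

lemma pmf_expectation_bind_finite:
  fixes f :: "'b \<Rightarrow> real"
  assumes "finite (set_pmf p)" "\<And>x. x \<in> set_pmf p \<Longrightarrow> finite (set_pmf (q x))"
  shows "measure_pmf.expectation (bind_pmf p q) f =
    measure_pmf.expectation p (\<lambda>x. measure_pmf.expectation (q x) f)"
proof -
  have "measure_pmf.expectation (bind_pmf p q) f =
      (\<Sum>a\<in>set_pmf p. pmf p a *\<^sub>R measure_pmf.expectation (q a) f)"
    by (rule pmf_expectation_bind) (use assms in auto)
  also have "\<dots> = measure_pmf.expectation p (\<lambda>x. measure_pmf.expectation (q x) f)"
    by (rule integral_measure_pmf[symmetric]) (use assms in auto)
  finally show ?thesis .
qed

lemma finite_set_pmf_semigroup:
  assumes "finite E" "transition_semigroup E K" "0 \<le> t" "x \<in> E"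
  shows "finite (set_pmf (K t x))"
  using assms by (auto simp: transition_semigroup_def intro: finite_subset[of _ E])

text \<open>Chapman-Kolmogorov splits off the first step: the induction hypothesis is used at the
  random state reached after time \<open>h\<close>, and because it is affine in \<open>f\<close> it
  can be averaged. Nonnegativity of \<open>c\<close> keeps the direction of the inequality when
  \<open>step\<close> is multiplied by \<open>c ^ n\<close>.\<close>

lemma semigroup_iterate_bound:
  fixes f :: "'s \<Rightarrow> real"
  assumes fin: "finite E" and K: "transition_semigroup E K"
    and h: "0 \<le> h" and c: "0 \<le> c"
    and step: "\<And>y. y \<in> E \<Longrightarrow> measure_pmf.expectation (K h y) f - b \<le> c * (f y - b)"
    and x: "x \<in> E"
  shows "measure_pmf.expectation (K (real n * h) x) f - b \<le> c ^ n * (f x - b)"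
  using x
proof (induction n arbitrary: x)
  case 0
  then show ?case using K by (simp add: transition_semigroup_def)
next
  case (Suc n)
  have sub: "set_pmf (K t y) \<subseteq> E" if "0 \<le> t" "y \<in> E" for t y
    using K that by (simp add: transition_semigroup_def)
  note fins = finite_set_pmf_semigroup[OF fin K]
  have int: "integrable (measure_pmf (K h x)) u" for u :: "'s \<Rightarrow> real"
    by (rule integrable_measure_pmf_finite) (rule fins[OF h Suc.prems])
  have eq: "K (real (Suc n) * h) x = bind_pmf (K h x) (K (real n * h))"
    using K h Suc.prems by (simp add: transition_semigroup_def algebra_simps)
  have "measure_pmf.expectation (K (real (Suc n) * h) x) f =
      measure_pmf.expectation (K h x) (\<lambda>y. measure_pmf.expectation (K (real n * h) y) f)"
    unfolding eq using sub[OF h Suc.prems] h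
    by (intro pmf_expectation_bind_finite fins) (auto simp: Suc.prems)
  also have "\<dots> \<le> measure_pmf.expectation (K h x) (\<lambda>y. c ^ n * (f y - b) + b)"
    using Suc.IH sub[OF h Suc.prems]
    by (intro pmf_expectation_mono fins h Suc.prems) (fastforce simp: algebra_simps)
  also have "\<dots> = c ^ n * (measure_pmf.expectation (K h x) f - b) + b"
    using int by (simp add: algebra_simps)
  also have "\<dots> \<le> c ^ n * (c * (f x - b)) + b"
    using mult_left_mono[OF step[OF Suc.prems], of "c ^ n"] c by simp
  finally show ?case by (simp add: algebra_simps)
qed

text \<open>
  Discretise time with step \<open>t / n\<close>: each step contracts the distance to the level
  \<open>(B + \<epsilon>) / A\<close> by the factor \<open>1 - A t / n\<close>.
\<close>

lemma semigroup_gronwall: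
  fixes f :: "'s \<Rightarrow> real"
  assumes fin: "finite E" and K: "transition_semigroup E K" and gen: "has_generator E K L"
    and A: "0 < A" and L: "\<And>y. y \<in> E \<Longrightarrow> L f y \<le> B - A * f y"
    and t: "0 \<le> t" and x: "x \<in> E"
  shows "measure_pmf.expectation (K t x) f \<le> B / A + exp (- A * t) * (f x - B / A)"
proof (cases "t = 0")
  case True
  then show ?thesis using K x by (simp add: transition_semigroup_def)
next
  case False
  with t have t: "t > 0" by simp
  have lim: "filterlim (\<lambda>n. t / real n) (at_right 0) sequentially"
    using t by real_asymp
  \<comment> \<open>The generator controls the increment over a step only in the limit. The slack
    \<open>e\<close> turns this into a strict inequality valid for all small steps at once,
    uniformly over the finite set \<open>E\<close>; it is removed afterwards by letting
    \<open>e\<close> tend to 0.\<close>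
  have main: "measure_pmf.expectation (K t x) f \<le> b + exp (- A * t) * (f x - b)"
    if e: "e > 0" and b: "b = (B + e) / A" for e b
  proof -
    have "\<forall>\<^sub>F h in at_right 0. \<forall>y\<in>E. (measure_pmf.expectation (K h y) f - f y) / h < L f y + e"
      using gen e fin
      by (intro eventually_ball_finite) (auto simp: has_generator_def intro!: order_tendstoD(2))
    then have "\<forall>\<^sub>F n in sequentially. \<forall>y\<in>E.
        (measure_pmf.expectation (K (t / real n) y) f - f y) / (t / real n) < L f y + e"
      using lim by (rule eventually_compose_filterlim)
    moreover have "\<forall>\<^sub>F n in sequentially. A * t / real n < 1"
      using A t by real_asymp
    moreover have "\<forall>\<^sub>F n in sequentially. n > 0" by (rule eventually_gt_at_top)
    ultimately have "\<forall>\<^sub>F n in sequentially. measure_pmf.expectation (K t x) f - b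
        \<le> (1 + (- A * t) / real n) ^ n * (f x - b)"
    proof eventually_elim
      case (elim n)
      define h where "h = t / real n"
      have h: "h > 0" "real n * h = t" using elim t by (auto simp: h_def)
      have "measure_pmf.expectation (K (real n * h) x) f - b \<le> (1 - A * h) ^ n * (f x - b)"
      proof (rule semigroup_iterate_bound[OF fin K _ _ _ x])
        show "0 \<le> h" "0 \<le> 1 - A * h" using h elim by (auto simp: h_def)
        fix y assume y: "y \<in> E"
        have "(measure_pmf.expectation (K h y) f - f y) / h \<le> B - A * f y + e"
          using elim(1) L[OF y] y unfolding h_def by fastforce
        then have "measure_pmf.expectation (K h y) f - f y \<le> (B + e - A * f y) * h"
          using h by (simp add: divide_simps algebra_simps)
        moreover have "B + e = A * b" using A by (simp add: b)
        ultimately show "measure_pmf.expectation (K h y) f - b \<le> (1 - A * h) * (f y - b)"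
          by (simp add: algebra_simps)
      qed
      then show ?case using h by (simp add: h_def)
    qed
    moreover have "(\<lambda>n. (1 + (- A * t) / real n) ^ n * (f x - b))
        \<longlonglongrightarrow> exp (- A * t) * (f x - b)"
      by (intro tendsto_intros tendsto_exp_limit_sequentially)
    ultimately have "measure_pmf.expectation (K t x) f - b \<le> exp (- A * t) * (f x - b)"
      by (intro tendsto_lowerbound[where F = sequentially]) auto
    then show ?thesis by simp
  qed
  have "\<forall>\<^sub>F e in at_right 0. measure_pmf.expectation (K t x) f
      \<le> (B + e) / A + exp (- A * t) * (f x - (B + e) / A)"
    using main by (auto simp: eventually_at_right_less intro: eventually_at_rightI[of 0 1])
  moreover have "((\<lambda>e. (B + e) / A + exp (- A * t) * (f x - (B + e) / A))
      \<longlongrightarrow> (B + 0) / A + exp (- A * t) * (f x - (B + 0) / A)) (at_right 0)"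
    using A by (intro tendsto_intros) auto
  ultimately show ?thesis
    using tendsto_lowerbound[of _ _ "at_right (0::real)"] by fastforce
qed

section \<open>Generator and carre du champ on linear statistics\<close>

text \<open>Weights are indexed by sites rather than sampled from a function on the unit interval,
  so that weights depending on \<open>N\<close>, such as the corrected mass and the discrete
  eigenvectors, are covered.\<close>

definition linear_stat :: "nat \<Rightarrow> (nat \<Rightarrow> real) \<Rightarrow> config \<Rightarrow> real" where
  "linear_stat N g \<eta> = (\<Sum>x = 1..N - 1. g x * real (\<eta> x)) / real N"

lemma empirical_eq_linear_stat:
  "empirical N \<eta> F = linear_stat N (\<lambda>x. F (real x / real N)) \<eta>"
  by (simp add: empirical_def linear_stat_def mult.commute)

lemma finite_configs: "finite (configs N)"
  by (simp add: configs_def finite_PiE)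

lemma configs_values: "\<eta> \<in> configs N \<Longrightarrow> x \<in> {1..N - 1} \<Longrightarrow> \<eta> x = 0 \<or> \<eta> x = 1"
  by (auto simp: configs_def PiE_iff)

lemma configs_unit: "\<eta> \<in> configs N \<Longrightarrow> x \<in> {1..N - 1} \<Longrightarrow> real (\<eta> x) \<in> {0..1}"
  using configs_values by fastforce

lemma abs_linear_stat_le:
  assumes "\<eta> \<in> configs N" "\<And>x. x \<in> {1..N - 1} \<Longrightarrow> \<bar>g x\<bar> \<le> C" "0 \<le> C"
  shows "\<bar>linear_stat N g \<eta>\<bar> \<le> C"
proof (cases "N = 0")
  case False
  have "\<bar>\<Sum>x = 1..N - 1. g x * real (\<eta> x)\<bar> \<le> (\<Sum>x = 1..N - 1. C)"
  proof (rule order.trans[OF sum_abs sum_mono])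
    fix x assume x: "x \<in> {1..N - 1}"
    from configs_values[OF assms(1) x] show "\<bar>g x * real (\<eta> x)\<bar> \<le> C"
      using assms(2)[OF x] assms(3) by auto
  qed
  also have "\<dots> \<le> real N * C" using assms(3) by (simp add: mult_right_mono)
  finally show ?thesis using False by (simp add: linear_stat_def divide_simps mult.commute)
qed (simp add: linear_stat_def assms)

lemma linear_stat_diff: "linear_stat N g \<eta> - linear_stat N h \<eta> = linear_stat N (\<lambda>x. g x - h x) \<eta>"
  by (simp add: linear_stat_def diff_divide_distrib[symmetric] sum_subtractf[symmetric] algebra_simps)

lemma linear_stat_upd:
  assumes "x \<in> {1..N - 1}"
  shows "linear_stat N g (\<eta>(x := v)) = linear_stat N g \<eta> + g x * (real v - real (\<eta> x)) / real N"
proof -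
  have "(\<Sum>y = 1..N - 1. g y * real ((\<eta>(x := v)) y)) =
      (\<Sum>y = 1..N - 1. g y * real (\<eta> y) + (if y = x then g x * (real v - real (\<eta> x)) else 0))"
    by (rule sum.cong) (auto simp: algebra_simps)
  also have "\<dots> = (\<Sum>y = 1..N - 1. g y * real (\<eta> y)) + g x * (real v - real (\<eta> x))"
    using assms by (simp add: sum.distrib)
  finally show ?thesis by (simp add: linear_stat_def add_divide_distrib)
qed

lemma linear_stat_exchange:
  assumes "x \<in> {1..N - 2}"
  shows "linear_stat N g (exchange \<eta> x) - linear_stat N g \<eta> =
    (g x - g (x + 1)) * (real (\<eta> (x + 1)) - real (\<eta> x)) / real N"
proof -
  have "x \<in> {1..N - 1}" "x + 1 \<in> {1..N - 1}" using assms by auto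
  then show ?thesis
    unfolding exchange_def by (simp add: linear_stat_upd add_divide_distrib[symmetric] algebra_simps
      diff_divide_distrib)
qed

lemma linear_stat_flip:
  assumes "\<eta> \<in> configs N" "x \<in> {1..N - 1}"
  shows "linear_stat N g (flip \<eta> x) - linear_stat N g \<eta> = g x * (1 - 2 * real (\<eta> x)) / real N"
  using configs_values[OF assms] assms(2) unfolding flip_def by (auto simp: linear_stat_upd)

definition carre_du_champ :: "real \<Rightarrow> real \<Rightarrow> nat \<Rightarrow> (config \<Rightarrow> real) \<Rightarrow> config \<Rightarrow> real" where
  "carre_du_champ \<alpha> \<beta> N F \<eta> =
     real N ^ 3 * (\<Sum>x = 1..N - 2. (F (exchange \<eta> x) - F \<eta>)\<^sup>2) +
     real N * (\<Sum>x \<in> {1, N - 1}.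
        (reservoir \<alpha> \<beta> x * (1 - real (\<eta> x)) + (1 - reservoir \<alpha> \<beta> x) * real (\<eta> x))
        * (F (flip \<eta> x) - F \<eta>)\<^sup>2)"

lemma accelerated_generator_square:
  "accelerated_generator \<alpha> \<beta> N (\<lambda>\<xi>. (F \<xi> - c)\<^sup>2) \<eta> =
    2 * (F \<eta> - c) * accelerated_generator \<alpha> \<beta> N F \<eta> + carre_du_champ \<alpha> \<beta> N F \<eta>"
proof -
  have *: "(a - c)\<^sup>2 - (b - c)\<^sup>2 = 2 * (b - c) * (a - b) + (a - b)\<^sup>2" for a b :: real
    by (simp add: power2_eq_square algebra_simps)
  show ?thesis
    unfolding accelerated_generator_def bulk_generator_def boundary_generator_def
      carre_du_champ_def *
    by (simp only: distrib_left sum.distrib sum_distrib_left mult.assoc mult.left_commute ac_simps)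
qed

lemma accelerated_generator_affine:
  "accelerated_generator \<alpha> \<beta> N (\<lambda>\<xi>. a * F \<xi> + c) \<eta> = a * accelerated_generator \<alpha> \<beta> N F \<eta>"
proof -
  have *: "(a * u + c) - (a * v + c) = a * (u - v)" for u v :: real
    by (simp add: algebra_simps)
  show ?thesis
    unfolding accelerated_generator_def bulk_generator_def boundary_generator_def *
    by (simp only: distrib_left sum_distrib_left mult.assoc mult.left_commute ac_simps)
qed

text \<open>The reservoir dynamics closes because rate times increment is affine: an empty site
  contributes \<open>r\<close>, an occupied one \<open>-(1 - r)\<close>, that is
  \<open>r - \<eta> x\<close> in both cases. The factor 1 / N of the statistic turns the speeds
  \<open>N ^ 3\<close> and \<open>N\<close> into \<open>N ^ 2\<close> and 1.\<close>

lemma generator_linear_stat: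
  assumes N: "N \<ge> 3" and \<eta>: "\<eta> \<in> configs N"
  shows "accelerated_generator \<alpha> \<beta> N (linear_stat N g) \<eta> =
    real N ^ 2 * (\<Sum>x = 1..N - 2. (g x - g (x + 1)) * (real (\<eta> (x + 1)) - real (\<eta> x)))
    + g 1 * (\<alpha> - real (\<eta> 1)) + g (N - 1) * (\<beta> - real (\<eta> (N - 1)))"
proof -
  have bulk: "bulk_generator N (linear_stat N g) \<eta> =
      (\<Sum>x = 1..N - 2. (g x - g (x + 1)) * (real (\<eta> (x + 1)) - real (\<eta> x))) / real N"
    unfolding bulk_generator_def sum_divide_distrib
    by (rule sum.cong) (auto simp: linear_stat_exchange)
  have flip1: "(r * (1 - real (\<eta> x)) + (1 - r) * real (\<eta> x))
      * (linear_stat N g (flip \<eta> x) - linear_stat N g \<eta>) = g x * (r - real (\<eta> x)) / real N"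
    if "x \<in> {1..N - 1}" for x r
    using configs_values[OF \<eta> that] by (auto simp: linear_stat_flip[OF \<eta> that])
  have "(\<Sum>x \<in> {1, N - 1}. (reservoir \<alpha> \<beta> x * (1 - real (\<eta> x)) + (1 - reservoir \<alpha> \<beta> x) * real (\<eta> x))
        * (linear_stat N g (flip \<eta> x) - linear_stat N g \<eta>)) =
      (\<Sum>x \<in> {1, N - 1}. g x * (reservoir \<alpha> \<beta> x - real (\<eta> x)) / real N)"
    by (rule sum.cong) (use N in \<open>auto intro!: flip1\<close>)
  \<comment> \<open>Otherwise the sum over the set \<open>{1, N - 1}\<close> would have a single
    term.\<close>
  moreover have "1 \<noteq> N - 1" using N by simp
  ultimately have bdry: "boundary_generator \<alpha> \<beta> N (linear_stat N g) \<eta> =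
      (g 1 * (\<alpha> - real (\<eta> 1)) + g (N - 1) * (\<beta> - real (\<eta> (N - 1)))) / real N"
    unfolding boundary_generator_def by (simp add: reservoir_def add_divide_distrib)
  show ?thesis
    unfolding accelerated_generator_def bulk bdry using N
    by (simp add: power3_eq_cube power2_eq_square)
qed

text \<open>An exchange changes the statistic by at most D / N and there are fewer than N bonds,
  which against the speed \<open>N ^ 3\<close> leaves \<open>(N D) ^ 2\<close>. A flip changes it by
  at most C / N at rate at most 1, at two sites, with speed N.\<close>

lemma carre_du_champ_linear_stat_le:
  assumes N: "N \<ge> 3" and \<eta>: "\<eta> \<in> configs N"
    and r: "\<alpha> \<in> {0..1}" "\<beta> \<in> {0..1}"
    and grad: "\<And>x. x \<in> {1..N - 2} \<Longrightarrow> \<bar>g x - g (x + 1)\<bar> \<le> D"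
    and bdry: "\<bar>g 1\<bar> \<le> C" "\<bar>g (N - 1)\<bar> \<le> C"
  shows "carre_du_champ \<alpha> \<beta> N (linear_stat N g) \<eta> \<le> (real N * D)\<^sup>2 + 2 * C\<^sup>2 / real N"
proof -
  have "(\<Sum>x = 1..N - 2. (linear_stat N g (exchange \<eta> x) - linear_stat N g \<eta>)\<^sup>2)
      \<le> (\<Sum>x = 1..N - 2. (D / real N)\<^sup>2)"
  proof (rule sum_mono)
    fix x assume x: "x \<in> {1..N - 2}"
    have "\<bar>real (\<eta> (x + 1)) - real (\<eta> x)\<bar> \<le> 1"
      using configs_values[OF \<eta>, of x] configs_values[OF \<eta>, of "x + 1"] x by force
    then have "\<bar>(g x - g (x + 1)) * (real (\<eta> (x + 1)) - real (\<eta> x))\<bar> \<le> D * 1"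
      unfolding abs_mult using grad[OF x] by (intro mult_mono) auto
    then have "\<bar>linear_stat N g (exchange \<eta> x) - linear_stat N g \<eta>\<bar> \<le> D / real N"
      unfolding linear_stat_exchange[OF x] by (simp add: divide_right_mono)
    then show "(linear_stat N g (exchange \<eta> x) - linear_stat N g \<eta>)\<^sup>2 \<le> (D / real N)\<^sup>2"
      by (metis abs_ge_zero power2_abs power_mono)
  qed
  also have "\<dots> \<le> real N * (D / real N)\<^sup>2" by (simp add: mult_right_mono)
  finally have 1: "real N ^ 3 * (\<Sum>x = 1..N - 2. (linear_stat N g (exchange \<eta> x) - linear_stat N g \<eta>)\<^sup>2)
      \<le> real N ^ 3 * (real N * (D / real N)\<^sup>2)"
    by (intro mult_left_mono) auto
  have "(\<Sum>x \<in> {1, N - 1}. (reservoir \<alpha> \<beta> x * (1 - real (\<eta> x)) + (1 - reservoir \<alpha> \<beta> x) * real (\<eta> x))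
        * (linear_stat N g (flip \<eta> x) - linear_stat N g \<eta>)\<^sup>2) \<le> (\<Sum>x \<in> {1, N - 1}. (C / real N)\<^sup>2)"
  proof (rule sum_mono)
    fix x assume x: "x \<in> {1, N - 1}"
    then have x': "x \<in> {1..N - 1}" using N by auto
    note v = configs_values[OF \<eta> x']
    have "\<bar>g x * (1 - 2 * real (\<eta> x))\<bar> \<le> C" using v x bdry by (auto simp: abs_mult)
    then have "\<bar>linear_stat N g (flip \<eta> x) - linear_stat N g \<eta>\<bar> \<le> C / real N"
      unfolding linear_stat_flip[OF \<eta> x'] by (simp add: divide_right_mono)
    then have "(linear_stat N g (flip \<eta> x) - linear_stat N g \<eta>)\<^sup>2 \<le> (C / real N)\<^sup>2"
      by (metis abs_ge_zero power2_abs power_mono)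
    moreover have "0 \<le> reservoir \<alpha> \<beta> x * (1 - real (\<eta> x)) + (1 - reservoir \<alpha> \<beta> x) * real (\<eta> x)"
        "reservoir \<alpha> \<beta> x * (1 - real (\<eta> x)) + (1 - reservoir \<alpha> \<beta> x) * real (\<eta> x) \<le> 1"
      using v r by (auto simp: reservoir_def)
    ultimately show "(reservoir \<alpha> \<beta> x * (1 - real (\<eta> x)) + (1 - reservoir \<alpha> \<beta> x) * real (\<eta> x))
        * (linear_stat N g (flip \<eta> x) - linear_stat N g \<eta>)\<^sup>2 \<le> (C / real N)\<^sup>2"
      using mult_mono[of _ 1] by fastforce
  qed
  also have "\<dots> = 2 * (C / real N)\<^sup>2" using N by simp
  finally have "real N * (\<Sum>x \<in> {1, N - 1}.
        (reservoir \<alpha> \<beta> x * (1 - real (\<eta> x)) + (1 - reservoir \<alpha> \<beta> x) * real (\<eta> x))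
        * (linear_stat N g (flip \<eta> x) - linear_stat N g \<eta>)\<^sup>2) \<le> real N * (2 * (C / real N)\<^sup>2)"
    by (intro mult_left_mono) auto
  with 1 have "carre_du_champ \<alpha> \<beta> N (linear_stat N g) \<eta>
      \<le> real N ^ 3 * (real N * (D / real N)\<^sup>2) + real N * (2 * (C / real N)\<^sup>2)"
    unfolding carre_du_champ_def by (rule add_mono)
  also have "\<dots> = (real N * D)\<^sup>2 + 2 * C\<^sup>2 / real N"
    using N by (simp add: power2_eq_square power3_eq_cube)
  finally show ?thesis .
qed

section \<open>Summation by parts and the corrected total mass\<close>

text \<open>The boundary terms are written with the ghost sites 0 and \<open>n + 1\<close>, so that
  they vanish for a discrete Neumann weight and otherwise display its prescribed flux.\<close>

lemma summation_by_parts: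
  fixes g e :: "nat \<Rightarrow> real"
  assumes "n \<ge> 1"
  shows "(\<Sum>x = 1..n - 1. (g x - g (x + 1)) * (e (x + 1) - e x)) =
    (\<Sum>x = 1..n. e x * (g (x + 1) - 2 * g x + g (x - 1))) + e 1 * (g 1 - g 0) - e n * (g (n + 1) - g n)"
  using assms
proof (induction n rule: dec_induct)
  case base
  then show ?case by (simp add: algebra_simps)
next
  case (step n)
  then obtain k where "n = Suc k" by (cases n) auto
  with step.IH show ?case by (simp add: algebra_simps)
qed


text \<open>
  The added parabola solves the discrete Neumann problem whose right-hand side is the mass created
  at the two boundary sites minus its spatial average; it replaces \<open>\<eta> 1 + \<eta> (N - 1)\<close> in the drift of
  the mass by twice the mean density, at the price of an error of order \<open>1 / N\<close>.
\<close>

definition corrected_weight :: "nat \<Rightarrow> nat \<Rightarrow> real" where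
  "corrected_weight N x = 1 + real x * (real N - real x) / (real N ^ 2 * (real N - 1))"

lemma corrected_weight_bounds:
  assumes "N \<ge> 3" "x \<le> N"
  shows "0 \<le> corrected_weight N x - 1" "corrected_weight N x - 1 \<le> 1 / real N"
proof -
  have le: "real x * (real N - real x) \<le> real N * (real N - 1)"
  proof (cases "x = 0")
    case False
    then show ?thesis using assms by (intro mult_mono) auto
  qed (use assms in auto)
  show "0 \<le> corrected_weight N x - 1" using assms by (simp add: corrected_weight_def)
  have "corrected_weight N x - 1 \<le> real N * (real N - 1) / (real N ^ 2 * (real N - 1))"
    unfolding corrected_weight_def add_diff_cancel_left'
    by (rule divide_right_mono[OF le]) (use assms in auto)
  also have "\<dots> = 1 / real N" using assms by (simp add: power2_eq_square)
  finally show "corrected_weight N x - 1 \<le> 1 / real N" .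
qed

lemma corrected_weight_step:
  assumes "N \<ge> 3"
  shows "corrected_weight N (x + 1) - corrected_weight N x =
    (real N - 1 - 2 * real x) / (real N ^ 2 * (real N - 1))"
  by (simp add: corrected_weight_def diff_divide_distrib[symmetric] algebra_simps)

lemma corrected_weight_laplacian:
  assumes "N \<ge> 3" "x \<ge> 1"
  shows "corrected_weight N (x + 1) - 2 * corrected_weight N x + corrected_weight N (x - 1) =
    - 2 / (real N ^ 2 * (real N - 1))"
proof -
  have "corrected_weight N (x + 1) - 2 * corrected_weight N x + corrected_weight N (x - 1) =
      (corrected_weight N (x + 1) - corrected_weight N x) -
      (corrected_weight N (x - 1 + 1) - corrected_weight N (x - 1))"
    using assms by simp
  also have "\<dots> = (real N - 1 - 2 * real x - (real N - 1 - 2 * real (x - 1)))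
      / (real N ^ 2 * (real N - 1))"
    unfolding corrected_weight_step[OF assms(1)] diff_divide_distrib by simp
  also have "real N - 1 - 2 * real x - (real N - 1 - 2 * real (x - 1)) = - 2"
    using assms by (simp add: of_nat_diff)
  finally show ?thesis .
qed

text \<open>The flux of the parabola through each end is \<open>1 / N ^ 2\<close>; multiplied by
  \<open>N ^ 2\<close> it cancels the terms \<open>- \<eta> 1\<close> and
  \<open>- \<eta> (N - 1)\<close> created by the reservoirs. The constant Laplacian returns the same
  amount as a multiple of the total mass. What remains of the boundary carries the factor
  \<open>1 / N ^ 2\<close>, the excess of the weight over 1 at the two end sites.\<close>

lemma generator_corrected_mass:
  assumes N: "N \<ge> 3" and \<eta>: "\<eta> \<in> configs N"
  shows "accelerated_generator \<alpha> \<beta> N (linear_stat N (corrected_weight N)) \<eta> =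
    (\<alpha> + \<beta>) * (1 + 1 / real N ^ 2) - (real (\<eta> 1) + real (\<eta> (N - 1))) / real N ^ 2
    - 2 * real N / (real N - 1) * linear_stat N (\<lambda>_. 1) \<eta>"
proof -
  let ?g = "corrected_weight N"
  have N2: "N - 2 = (N - 1) - 1" "N - 1 + 1 = N" using N by auto
  have "(\<Sum>x = 1..N - 2. (?g x - ?g (x + 1)) * (real (\<eta> (x + 1)) - real (\<eta> x))) =
      (\<Sum>x = 1..N - 1. real (\<eta> x) * (?g (x + 1) - 2 * ?g x + ?g (x - 1)))
      + real (\<eta> 1) * (?g 1 - ?g 0) - real (\<eta> (N - 1)) * (?g (N - 1 + 1) - ?g (N - 1))"
    unfolding N2(1) by (rule summation_by_parts) (use N in auto)
  also have "(\<Sum>x = 1..N - 1. real (\<eta> x) * (?g (x + 1) - 2 * ?g x + ?g (x - 1))) =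
      (\<Sum>x = 1..N - 1. real (\<eta> x) * (- 2 / (real N ^ 2 * (real N - 1))))"
    by (rule sum.cong) (auto simp only: corrected_weight_laplacian[OF N] atLeastAtMost_iff)
  also have "\<dots> = - 2 / (real N * (real N - 1)) * linear_stat N (\<lambda>_. 1) \<eta>"
    using N by (simp add: linear_stat_def sum_distrib_right[symmetric] sum_negf
        sum_divide_distrib[symmetric] power2_eq_square mult_ac)
  also have "?g 1 - ?g 0 = 1 / real N ^ 2"
    using N by (simp add: corrected_weight_def divide_simps)
  also have "?g (N - 1 + 1) - ?g (N - 1) = - (1 / real N ^ 2)"
    using N unfolding N2 by (simp add: corrected_weight_def of_nat_diff divide_simps)
  finally have *: "(\<Sum>x = 1..N - 2. (?g x - ?g (x + 1)) * (real (\<eta> (x + 1)) - real (\<eta> x))) =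
      - 2 / (real N * (real N - 1)) * linear_stat N (\<lambda>_. 1) \<eta>
      + (real (\<eta> 1) + real (\<eta> (N - 1))) / real N ^ 2"
    by (simp add: add_divide_distrib)
  have g: "?g 1 = 1 + 1 / real N ^ 2" "?g (N - 1) = 1 + 1 / real N ^ 2"
    using N by (simp_all add: corrected_weight_def of_nat_diff)
  have "real N ^ 2 * (- 2 / (real N * (real N - 1)) * linear_stat N (\<lambda>_. 1) \<eta>) =
      - (2 * real N / (real N - 1) * linear_stat N (\<lambda>_. 1) \<eta>)"
    using N by (simp add: power2_eq_square)
  moreover have "real N ^ 2 * ((real (\<eta> 1) + real (\<eta> (N - 1))) / real N ^ 2) =
      real (\<eta> 1) + real (\<eta> (N - 1))"
    using N by simp
  ultimately have **: "real N ^ 2 * (- 2 / (real N * (real N - 1)) * linear_stat N (\<lambda>_. 1) \<eta>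
      + (real (\<eta> 1) + real (\<eta> (N - 1))) / real N ^ 2) =
      - (2 * real N / (real N - 1) * linear_stat N (\<lambda>_. 1) \<eta>) + (real (\<eta> 1) + real (\<eta> (N - 1)))"
    by (simp only: distrib_left)
  show ?thesis
    unfolding generator_linear_stat[OF N \<eta>] * g **
    by (simp add: algebra_simps add_divide_distrib diff_divide_distrib)
qed

lemma corrected_mass_near_mass:
  assumes "N \<ge> 3" "\<eta> \<in> configs N"
  shows "\<bar>linear_stat N (corrected_weight N) \<eta> - linear_stat N (\<lambda>_. 1) \<eta>\<bar> \<le> 1 / real N"
  unfolding linear_stat_diff
  by (rule abs_linear_stat_le[OF assms(2)])
    (use corrected_weight_bounds[OF assms(1)] in \<open>auto simp del: diff_ge_0_iff_ge\<close>)

text \<open>The upper bound counts the \<open>N - 1\<close> sites exactly; the drift estimate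
  divides by \<open>N - 1\<close> and thereby obtains 1 / N.\<close>

lemma mass_bounds:
  assumes "N \<ge> 3" "\<eta> \<in> configs N"
  shows "0 \<le> linear_stat N (\<lambda>_. 1) \<eta>" "linear_stat N (\<lambda>_. 1) \<eta> \<le> (real N - 1) / real N"
proof -
  show "0 \<le> linear_stat N (\<lambda>_. 1) \<eta>" by (simp add: linear_stat_def sum_nonneg)
  have "(\<Sum>x = 1..N - 1. real (\<eta> x)) \<le> (\<Sum>x = 1..N - 1. 1)"
    using configs_values[OF assms(2)] by (intro sum_mono) fastforce
  also have "\<dots> = real N - 1" using assms by (simp add: of_nat_diff)
  finally show "linear_stat N (\<lambda>_. 1) \<eta> \<le> (real N - 1) / real N"
    by (simp add: linear_stat_def divide_right_mono)
qed

text \<open>The constant is 5 = 1 + 2 + 2: the residual boundary term, twice the distance between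
  mass and corrected mass, and twice the discrepancy between N / (N - 1) and 1 applied to the
  mass.\<close>

lemma corrected_mass_drift:
  assumes N: "N \<ge> 3" and \<eta>: "\<eta> \<in> configs N" and r: "\<alpha> \<in> {0..1}" "\<beta> \<in> {0..1}"
  shows "\<bar>accelerated_generator \<alpha> \<beta> N (linear_stat N (corrected_weight N)) \<eta>
    + 2 * (linear_stat N (corrected_weight N) \<eta> - (\<alpha> + \<beta>) / 2)\<bar> \<le> 5 / real N"
proof -
  let ?F = "linear_stat N (corrected_weight N) \<eta>" and ?M = "linear_stat N (\<lambda>_. 1) \<eta>"
  let ?b = "\<alpha> + \<beta> - (real (\<eta> 1) + real (\<eta> (N - 1)))"
  have e: "real (\<eta> 1) \<in> {0..1}" "real (\<eta> (N - 1)) \<in> {0..1}"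
    using N by (intro configs_unit[OF \<eta>]; simp)+
  have "\<bar>?b\<bar> \<le> 2" using e r by auto
  then have "\<bar>?b / real N ^ 2\<bar> \<le> 2 / real N ^ 2" by (simp add: divide_right_mono)
  also have "\<dots> \<le> 1 / real N" using N by (simp add: power2_eq_square divide_simps)
  finally have 1: "\<bar>?b / real N ^ 2\<bar> \<le> 1 / real N" .
  have "?M / (real N - 1) \<le> (real N - 1) / real N / (real N - 1)"
    using mass_bounds(2)[OF N \<eta>] N by (intro divide_right_mono) auto
  then have 2: "0 \<le> ?M / (real N - 1)" "?M / (real N - 1) \<le> 1 / real N"
    using mass_bounds(1)[OF N \<eta>] N by auto
  have eq: "2 * real N / (real N - 1) * ?M = 2 * ?M + 2 * (?M / (real N - 1))"
    using N by (simp add: divide_simps) (simp add: algebra_simps)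
  have "accelerated_generator \<alpha> \<beta> N (linear_stat N (corrected_weight N)) \<eta> + 2 * (?F - (\<alpha> + \<beta>) / 2)
      = ?b / real N ^ 2 + 2 * (?F - ?M) - 2 * (?M / (real N - 1))"
    unfolding generator_corrected_mass[OF N \<eta>] eq
    by (simp add: algebra_simps diff_divide_distrib add_divide_distrib)
  moreover have "\<bar>u + 2 * v - 2 * w\<bar> \<le> 5 * c"
    if "\<bar>u\<bar> \<le> c" "\<bar>v\<bar> \<le> c" "0 \<le> w" "w \<le> c" for u v w c :: real
    using that by linarith
  from this[OF 1 corrected_mass_near_mass[OF N \<eta>] 2]
  have "\<bar>?b / real N ^ 2 + 2 * (?F - ?M) - 2 * (?M / (real N - 1))\<bar> \<le> 5 / real N" by simp
  ultimately show ?thesis by (simp only:)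
qed

text \<open>Exchanges conserve the plain mass, so the bulk sees only the gradient of the parabola,
  at most \<open>1 / N ^ 2\<close>. The noise comes mainly from the reservoirs, where the weight is
  at most 1 + 1 / N, hence at most 4 / 3.\<close>

lemma corrected_mass_carre_du_champ:
  assumes N: "N \<ge> 3" and \<eta>: "\<eta> \<in> configs N" and r: "\<alpha> \<in> {0..1}" "\<beta> \<in> {0..1}"
  shows "carre_du_champ \<alpha> \<beta> N (linear_stat N (corrected_weight N)) \<eta> \<le> 5 / real N"
proof -
  have "carre_du_champ \<alpha> \<beta> N (linear_stat N (corrected_weight N)) \<eta>
      \<le> (real N * (1 / real N ^ 2))\<^sup>2 + 2 * (4 / 3)\<^sup>2 / real N"
  proof (rule carre_du_champ_linear_stat_le[OF N \<eta> r])
    fix x assume x: "x \<in> {1..N - 2}"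
    then have "real x \<le> real N - 2" "1 \<le> real x" using N by auto
    then have "\<bar>real N - 1 - 2 * real x\<bar> \<le> real N - 1" by linarith
    then have "\<bar>corrected_weight N (x + 1) - corrected_weight N x\<bar>
        \<le> (real N - 1) / (real N ^ 2 * (real N - 1))"
      unfolding corrected_weight_step[OF N] abs_divide using N
      by (intro frac_le) auto
    then show "\<bar>corrected_weight N x - corrected_weight N (x + 1)\<bar> \<le> 1 / real N ^ 2"
      using N by (simp add: abs_minus_commute)
  next
    have "1 / real N \<le> 1 / 3" using N by (simp add: divide_simps)
    then show "\<bar>corrected_weight N 1\<bar> \<le> 4 / 3" "\<bar>corrected_weight N (N - 1)\<bar> \<le> 4 / 3"
      using corrected_weight_bounds[OF N, of 1] corrected_weight_bounds[OF N, of "N - 1"] N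
      by linarith+
  qed
  also have "\<dots> \<le> 5 / real N" using N by (simp add: power2_eq_square divide_simps)
  finally show ?thesis .
qed

text \<open>Gronwall is one-sided, so it is applied to \<open>G\<close> and to \<open>- G\<close>,
  which pins the mean to the solution of the differential equation, and then to the square of
  \<open>G\<close>, whose decay rate is 4. Almost matching first and second moments force a small
  variance around the deterministic value.\<close>

lemma corrected_mass_concentration:
  assumes N: "N \<ge> 3" and r: "\<alpha> \<in> {0..1}" "\<beta> \<in> {0..1}"
    and K: "transition_semigroup (configs N) K"
    and gen: "has_generator (configs N) K (accelerated_generator \<alpha> \<beta> N)"
    and t: "0 \<le> t" and x: "x \<in> configs N"
    and \<gamma>: "\<gamma> = (\<alpha> + \<beta>) / 2"
  shows "measure_pmf.expectation (K t x) (\<lambda>\<eta>. (linear_stat N (corrected_weight N) \<eta> -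
      (\<gamma> + exp (- 2 * t) * (linear_stat N (corrected_weight N) x - \<gamma>)))\<^sup>2) \<le> 20 / real N"
proof -
  let ?L = "accelerated_generator \<alpha> \<beta> N" and ?E = "measure_pmf.expectation (K t x)"
  define F where "F = linear_stat N (corrected_weight N)"
  define G where "G \<eta> = F \<eta> - \<gamma>" for \<eta>
  have int: "integrable (measure_pmf (K t x)) u" for u :: "config \<Rightarrow> real"
    by (intro integrable_measure_pmf_finite finite_set_pmf_semigroup[OF finite_configs K t x])
  have drift: "\<bar>?L F \<eta> + 2 * G \<eta>\<bar> \<le> 5 / real N" if "\<eta> \<in> configs N" for \<eta>
    using corrected_mass_drift[OF N that r] by (simp add: F_def G_def \<gamma>)
  have G2: "\<bar>G \<eta>\<bar> \<le> 2" if "\<eta> \<in> configs N" for \<eta>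
  proof -
    have "\<bar>F \<eta>\<bar> \<le> 4 / 3" unfolding F_def
    proof (rule abs_linear_stat_le[OF that])
      fix x assume "x \<in> {1..N - 1}"
      then have "x \<le> N" by auto
      moreover have "1 / real N \<le> 1 / 3" using N by (simp add: divide_simps)
      ultimately show "\<bar>corrected_weight N x\<bar> \<le> 4 / 3"
        using corrected_weight_bounds[OF N, of x] by linarith
    qed simp
    moreover have "0 \<le> corrected_weight N x" if "x \<in> {1..N - 1}" for x
      using corrected_weight_bounds(1)[OF N, of x] that by simp linarith
    then have "0 \<le> F \<eta>" unfolding F_def linear_stat_def
      by (intro divide_nonneg_nonneg sum_nonneg mult_nonneg_nonneg) auto
    moreover have "0 \<le> \<gamma>" "\<gamma> \<le> 1" using r by (auto simp: \<gamma>)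
    ultimately show ?thesis unfolding G_def by linarith
  qed
  have LG: "?L G \<eta> = ?L F \<eta>" and LnG: "?L (\<lambda>\<eta>. - G \<eta>) \<eta> = - ?L F \<eta>" for \<eta>
    using accelerated_generator_affine[of \<alpha> \<beta> N 1 F "- \<gamma>" \<eta>]
      accelerated_generator_affine[of \<alpha> \<beta> N "- 1" F \<gamma> \<eta>]
    by (simp_all add: G_def[abs_def])
  have e1: "exp (- 2 * t) \<le> 1" "0 < exp (- 2 * t)" using t by auto
  have up: "?E G \<le> 5 / (2 * real N) + exp (- 2 * t) * (G x - 5 / (2 * real N))"
    using semigroup_gronwall[OF finite_configs K gen, of 2 G "5 / real N" t x] drift t x
    by (simp add: LG abs_le_iff) (smt (verit) drift)
  have lo: "?E (\<lambda>\<eta>. - G \<eta>) \<le> 5 / (2 * real N) + exp (- 2 * t) * (- G x - 5 / (2 * real N))"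
    using semigroup_gronwall[OF finite_configs K gen, of 2 "\<lambda>\<eta>. - G \<eta>" "5 / real N" t x] drift t x
    by (simp add: LnG abs_le_iff) (smt (verit) drift)
  have "?E (\<lambda>\<eta>. - G \<eta>) = - ?E G" by simp
  moreover have "\<bar>v - w * y\<bar> \<le> c"
    if "v \<le> c + w * (y - c)" "- v \<le> c + w * (- y - c)" "0 \<le> w * c" for v w y c :: real
    using that unfolding right_diff_distrib by linarith
  ultimately have first: "\<bar>?E G - exp (- 2 * t) * G x\<bar> \<le> 5 / (2 * real N)"
    using up lo by simp
  \<comment> \<open>The 25 is 20 from the drift error, \<open>2 * \<bar>G\<bar> * (5 / N)\<close>
    with \<open>\<bar>G\<bar> \<le> 2\<close>, plus 5 from the carre du champ.\<close>
  have "?E (\<lambda>\<eta>. (F \<eta> - \<gamma>)\<^sup>2) \<le> 25 / real N / 4 + exp (- 4 * t) * ((F x - \<gamma>)\<^sup>2 - 25 / real N / 4)"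
  proof (rule semigroup_gronwall[OF finite_configs K gen _ _ t x])
    fix \<eta> assume \<eta>: "\<eta> \<in> configs N"
    have "G \<eta> * (?L F \<eta> + 2 * G \<eta>) \<le> \<bar>G \<eta>\<bar> * \<bar>?L F \<eta> + 2 * G \<eta>\<bar>"
      by (metis abs_ge_self abs_mult)
    also have "\<dots> \<le> 2 * (5 / real N)" using G2[OF \<eta>] drift[OF \<eta>] by (intro mult_mono) auto
    finally have "2 * G \<eta> * ?L F \<eta> \<le> 20 / real N - 4 * (G \<eta>)\<^sup>2"
      by (simp add: power2_eq_square algebra_simps)
    moreover have "carre_du_champ \<alpha> \<beta> N F \<eta> \<le> 5 / real N"
      unfolding F_def by (rule corrected_mass_carre_du_champ[OF N \<eta> r])
    ultimately show "?L (\<lambda>\<eta>. (F \<eta> - \<gamma>)\<^sup>2) \<eta> \<le> 25 / real N - 4 * (F \<eta> - \<gamma>)\<^sup>2"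
      unfolding accelerated_generator_square by (simp add: G_def)
  qed simp
  moreover have "exp (- 4 * t) = (exp (- 2 * t))\<^sup>2" by (simp flip: exp_of_nat_mult)
  moreover have "v \<le> c + (w * y)\<^sup>2" if "v \<le> c + z * (y\<^sup>2 - c)" "z = w\<^sup>2" "0 \<le> c" for v w y z c :: real
    using that(1) mult_nonneg_nonneg[OF zero_le_power2[of w] that(3)]
    unfolding that(2) power_mult_distrib right_diff_distrib by linarith
  ultimately have second: "?E (\<lambda>\<eta>. (G \<eta>)\<^sup>2) \<le> 25 / real N / 4 + (exp (- 2 * t) * G x)\<^sup>2"
    unfolding G_def by simp
  have "?E (\<lambda>\<eta>. (G \<eta> - exp (- 2 * t) * G x)\<^sup>2) =
      ?E (\<lambda>\<eta>. (G \<eta>)\<^sup>2 - 2 * (exp (- 2 * t) * G x) * G \<eta> + (exp (- 2 * t) * G x)\<^sup>2)"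
    by (simp add: power2_diff algebra_simps)
  also have "\<dots> = ?E (\<lambda>\<eta>. (G \<eta>)\<^sup>2) - 2 * (exp (- 2 * t) * G x) * ?E G + (exp (- 2 * t) * G x)\<^sup>2"
    using int by simp
  \<comment> \<open>The second-moment bound contains the square of the predicted mean; it combines
    with the cross term so that only the error of the first moment is left.\<close>
  also have "\<dots> \<le> 25 / real N / 4 - 2 * (exp (- 2 * t) * G x) * (?E G - exp (- 2 * t) * G x)"
    using second by (simp add: power2_eq_square algebra_simps)
  also have "\<dots> \<le> 25 / real N / 4 + 2 * (1 * 2) * (5 / (2 * real N))"
  proof -
    have "\<bar>exp (- 2 * t) * G x\<bar> \<le> 1 * 2"
      unfolding abs_mult using e1 G2[OF x] by (intro mult_mono) auto
    then have "\<bar>exp (- 2 * t) * G x\<bar> * \<bar>?E G - exp (- 2 * t) * G x\<bar> \<le> (1 * 2) * (5 / (2 * real N))"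
      using first by (intro mult_mono) auto
    then have "- ((exp (- 2 * t) * G x) * (?E G - exp (- 2 * t) * G x)) \<le> (1 * 2) * (5 / (2 * real N))"
      unfolding abs_mult[symmetric] by linarith
    then show ?thesis by linarith
  qed
  also have "\<dots> \<le> 20 / real N" using N by (simp add: divide_simps)
  finally show ?thesis by (simp add: G_def F_def algebra_simps)
qed

section \<open>Decay of the nonconstant discrete cosine modes\<close>

text \<open>This is the DCT-II basis: the eigenvectors of the Neumann Laplacian on a path of
  \<open>N - 1\<close> sites, sampled at the midpoints \<open>x - 1 / 2\<close>.\<close>

definition cosine_mode :: "nat \<Rightarrow> nat \<Rightarrow> nat \<Rightarrow> real" where
  "cosine_mode k N x = cos (real k * pi / (real N - 1) * (real x - 1 / 2))"

text \<open>The speed of the exchanges times the eigenvalue of minus the discrete Laplacian; for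
  fixed k it grows like \<open>(k * pi) ^ 2 * N\<close>.\<close>

definition relaxation_rate :: "nat \<Rightarrow> nat \<Rightarrow> real" where
  "relaxation_rate k N = real N ^ 3 * (2 * (1 - cos (real k * pi / (real N - 1))))"

lemma cosine_mode_laplacian:
  assumes "x \<ge> 1"
  shows "cosine_mode k N (x + 1) - 2 * cosine_mode k N x + cosine_mode k N (x - 1) =
    - (2 * (1 - cos (real k * pi / (real N - 1)))) * cosine_mode k N x"
proof -
  define \<theta> where "\<theta> = real k * pi / (real N - 1)"
  define u where "u = \<theta> * (real x - 1 / 2)"
  have "cosine_mode k N (x + 1) = cos (u + \<theta>)" "cosine_mode k N (x - 1) = cos (u - \<theta>)"
    "cosine_mode k N x = cos u"
    using assms unfolding cosine_mode_def \<theta>_def[symmetric] u_def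
    by (simp_all add: of_nat_diff algebra_simps)
  then show ?thesis unfolding \<theta>_def[symmetric] by (simp add: cos_add cos_diff algebra_simps)
qed

text \<open>The shift by \<open>1 / 2\<close> makes the mode satisfy discrete Neumann conditions at both ends.\<close>

lemma cosine_mode_neumann:
  assumes "N \<ge> 3"
  shows "cosine_mode k N 1 = cosine_mode k N 0" "cosine_mode k N N = cosine_mode k N (N - 1)"
proof -
  define \<theta> where "\<theta> = real k * pi / (real N - 1)"
  have \<theta>: "\<theta> * (real N - 1) = real k * pi" using assms by (simp add: \<theta>_def)
  have "\<theta> * (1 / 2) = - (\<theta> * (0 - 1 / 2))" by simp
  then show "cosine_mode k N 1 = cosine_mode k N 0"
    unfolding cosine_mode_def \<theta>_def[symmetric]
    by (metis cos_minus diff_add_cancel field_sum_of_halves of_nat_0 of_nat_1 add_diff_cancel)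
  \<comment> \<open>The last site and its ghost neighbour lie symmetrically about the phase
    \<open>k * pi\<close>, where the sine vanishes.\<close>
  have "\<theta> * (real N - 1 / 2) = real k * pi + \<theta> / 2" "\<theta> * (real (N - 1) - 1 / 2) = real k * pi - \<theta> / 2"
    using assms \<theta> by (simp_all add: of_nat_diff algebra_simps)
  then show "cosine_mode k N N = cosine_mode k N (N - 1)"
    unfolding cosine_mode_def \<theta>_def[symmetric] by (simp add: cos_add cos_diff)
qed

lemma generator_cosine_mode:
  assumes N: "N \<ge> 3" and \<eta>: "\<eta> \<in> configs N"
  shows "accelerated_generator \<alpha> \<beta> N (linear_stat N (cosine_mode k N)) \<eta> =
    - relaxation_rate k N * linear_stat N (cosine_mode k N) \<eta>
    + cosine_mode k N 1 * (\<alpha> - real (\<eta> 1)) + cosine_mode k N (N - 1) * (\<beta> - real (\<eta> (N - 1)))"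
proof -
  let ?g = "cosine_mode k N"
  let ?l = "2 * (1 - cos (real k * pi / (real N - 1)))"
  have N2: "N - 2 = (N - 1) - 1" "N - 1 + 1 = N" using N by auto
  have "(\<Sum>x = 1..N - 2. (?g x - ?g (x + 1)) * (real (\<eta> (x + 1)) - real (\<eta> x))) =
      (\<Sum>x = 1..N - 1. real (\<eta> x) * (?g (x + 1) - 2 * ?g x + ?g (x - 1)))
      + real (\<eta> 1) * (?g 1 - ?g 0) - real (\<eta> (N - 1)) * (?g (N - 1 + 1) - ?g (N - 1))"
    unfolding N2(1) by (rule summation_by_parts) (use N in auto)
  also have "\<dots> = (\<Sum>x = 1..N - 1. real (\<eta> x) * (?g (x + 1) - 2 * ?g x + ?g (x - 1)))"
    unfolding N2(2) using cosine_mode_neumann[OF N, of k] by simp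
  also have "\<dots> = (\<Sum>x = 1..N - 1. - ?l * (?g x * real (\<eta> x)))"
    by (rule sum.cong) (auto simp: cosine_mode_laplacian[simplified])
  also have "\<dots> = - ?l * (real N * linear_stat N ?g \<eta>)"
    using N by (simp add: linear_stat_def sum_distrib_left[symmetric])
  finally have *: "(\<Sum>x = 1..N - 2. (?g x - ?g (x + 1)) * (real (\<eta> (x + 1)) - real (\<eta> x))) =
      - ?l * (real N * linear_stat N ?g \<eta>)" .
  show ?thesis
    unfolding generator_linear_stat[OF N \<eta>] relaxation_rate_def *
    by (simp add: power2_eq_square power3_eq_cube algebra_simps)
qed

lemma abs_cosine_mode_le: "\<bar>cosine_mode k N x\<bar> \<le> 1"
  by (simp add: cosine_mode_def)

lemma abs_cos_diff_le: "\<bar>cos a - cos b\<bar> \<le> \<bar>a - b\<bar>" for a b :: real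
proof -
  have "\<bar>cos a - cos b\<bar> = 2 * \<bar>sin ((a + b) / 2)\<bar> * \<bar>sin ((b - a) / 2)\<bar>"
    by (simp add: cos_diff_cos abs_mult)
  also have "\<dots> \<le> 2 * 1 * \<bar>(b - a) / 2\<bar>"
    by (intro mult_mono abs_sin_x_le_abs_x) auto
  finally show ?thesis by simp
qed

text \<open>The squared mode is damped at rate \<open>2 * relaxation_rate k N\<close> against a
  source that stays bounded in \<open>N\<close>. Bounding the initial square by 1 makes the estimate
  uniform in the starting configuration.\<close>

lemma cosine_mode_decay:
  assumes N: "N \<ge> 3" and r: "\<alpha> \<in> {0..1}" "\<beta> \<in> {0..1}"
    and K: "transition_semigroup (configs N) K"
    and gen: "has_generator (configs N) K (accelerated_generator \<alpha> \<beta> N)"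
    and t: "0 \<le> t" and x: "x \<in> configs N" and rate: "relaxation_rate k N > 0"
  shows "measure_pmf.expectation (K t x) (\<lambda>\<eta>. (linear_stat N (cosine_mode k N) \<eta>)\<^sup>2)
    \<le> (5 + (real N * (real k * pi / (real N - 1)))\<^sup>2) / (2 * relaxation_rate k N)
      + exp (- (2 * relaxation_rate k N) * t)"
proof -
  let ?L = "accelerated_generator \<alpha> \<beta> N"
  define F where "F = linear_stat N (cosine_mode k N)"
  define D where "D = real k * pi / (real N - 1)"
  define R where "R = relaxation_rate k N"
  \<comment> \<open>Here 5 = 4 + 1: \<open>2 * F * b\<close> with
    \<open>\<bar>F\<bar> \<le> 1\<close> and reservoir term \<open>\<bar>b\<bar> \<le> 2\<close>,
    and the boundary part 2 / N of the carre du champ. The other summand is its bulk part.\<close>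
  let ?B = "5 + (real N * D)\<^sup>2"
  have F1: "\<bar>F \<eta>\<bar> \<le> 1" if "\<eta> \<in> configs N" for \<eta>
    unfolding F_def by (rule abs_linear_stat_le[OF that]) (auto simp: abs_cosine_mode_le)
  have "measure_pmf.expectation (K t x) (\<lambda>\<eta>. (F \<eta> - 0)\<^sup>2)
      \<le> ?B / (2 * R) + exp (- (2 * R) * t) * ((F x - 0)\<^sup>2 - ?B / (2 * R))"
  proof (rule semigroup_gronwall[OF finite_configs K gen _ _ t x])
    show "0 < 2 * R" using rate by (simp add: R_def)
    fix \<eta> assume \<eta>: "\<eta> \<in> configs N"
    define b where "b = cosine_mode k N 1 * (\<alpha> - real (\<eta> 1))
      + cosine_mode k N (N - 1) * (\<beta> - real (\<eta> (N - 1)))"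
    have e: "real (\<eta> 1) \<in> {0..1}" "real (\<eta> (N - 1)) \<in> {0..1}"
      using N by (intro configs_unit[OF \<eta>]; simp)+
    have "\<bar>cosine_mode k N 1 * (\<alpha> - real (\<eta> 1))\<bar> \<le> 1 * 1"
      unfolding abs_mult using e r
      by (intro mult_mono abs_cosine_mode_le) auto
    moreover have "\<bar>cosine_mode k N (N - 1) * (\<beta> - real (\<eta> (N - 1)))\<bar> \<le> 1 * 1"
      unfolding abs_mult using e r
      by (intro mult_mono abs_cosine_mode_le) auto
    ultimately have "\<bar>b\<bar> \<le> 2" unfolding b_def by linarith
    then have "\<bar>F \<eta>\<bar> * \<bar>b\<bar> \<le> 1 * 2" using F1[OF \<eta>] by (intro mult_mono) auto
    then have Fb: "F \<eta> * b \<le> 2" unfolding abs_mult[symmetric] by linarith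
    have LF: "?L F \<eta> = - R * F \<eta> + b"
      unfolding F_def b_def R_def generator_cosine_mode[OF N \<eta>] by simp
    have "carre_du_champ \<alpha> \<beta> N F \<eta> \<le> (real N * D)\<^sup>2 + 2 * 1\<^sup>2 / real N"
      unfolding F_def
    proof (rule carre_du_champ_linear_stat_le[OF N \<eta> r])
      fix x
      show "\<bar>cosine_mode k N x - cosine_mode k N (x + 1)\<bar> \<le> D"
        using abs_cos_diff_le[of "D * (real x - 1 / 2)" "D * (real (x + 1) - 1 / 2)"] N
        unfolding cosine_mode_def D_def[symmetric]
        by (simp add: algebra_simps) (simp add: D_def)
    qed (rule abs_cosine_mode_le)+
    moreover have "2 * 1\<^sup>2 / real N \<le> 1" using N by simp
    ultimately have "carre_du_champ \<alpha> \<beta> N F \<eta> \<le> (real N * D)\<^sup>2 + 1" by linarith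
    with Fb show "?L (\<lambda>\<eta>. (F \<eta> - 0)\<^sup>2) \<eta> \<le> ?B - 2 * R * (F \<eta> - 0)\<^sup>2"
      unfolding accelerated_generator_square LF by (simp add: algebra_simps power2_eq_square)
  qed
  also have "\<dots> \<le> ?B / (2 * R) + exp (- (2 * R) * t) * 1"
  proof -
    have "0 \<le> ?B / (2 * R)" using rate by (simp add: R_def)
    moreover have "(F x)\<^sup>2 \<le> 1" using F1[OF x] by (simp add: abs_square_le_1)
    ultimately show ?thesis by (intro add_left_mono mult_left_mono) auto
  qed
  finally show ?thesis by (simp add: F_def D_def R_def)
qed

lemma relaxation_rate_at_top:
  assumes "k \<ge> 1"
  shows "filterlim (relaxation_rate k) at_top sequentially"
  unfolding relaxation_rate_def using assms by real_asymp


section \<open>From the law on path space to one-time marginals\<close>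

text \<open>Integrating the Markov property at \<open>s = 0\<close> identifies the law at time
  \<open>t\<close>: conditional expectation preserves the integral, and the right-hand side depends
  on the path only through the initial state, whose law is \<open>\<mu>\<close>.\<close>

lemma markov_law_marginal:
  fixes E :: "'s::topological_space set"
  assumes law: "markov_law T E L \<mu> P" and fin: "finite E" and \<mu>: "set_pmf \<mu> \<subseteq> E"
  obtains K where "transition_semigroup E K" "has_generator E K L"
    "\<And>f t. 0 \<le> t \<Longrightarrow> t \<le> T \<Longrightarrow>
      (LINT \<omega>|P. f (\<omega> t) :: real) = measure_pmf.expectation (bind_pmf \<mu> (K t)) f"
proof -
  from law obtain K where K: "transition_semigroup E K" "has_generator E K L"
    and cond: "\<And>f s t. 0 \<le> s \<Longrightarrow> s \<le> t \<Longrightarrow> t \<le> T \<Longrightarrow>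
      (AE \<omega> in P. real_cond_exp P (past T E s) (\<lambda>\<omega>'. f (\<omega>' t)) \<omega>
        = measure_pmf.expectation (K (t - s) (\<omega> s)) f)"
    unfolding markov_law_def by blast
  have prob: "prob_space P" and sets: "sets P = sets (path_space T E)"
    and init: "distr P (count_space UNIV) (\<lambda>\<omega>. \<omega> 0) = measure_pmf \<mu>"
    using law by (auto simp: markov_law_def)
  interpret prob_space P by (rule prob)
  have space: "space P = cadlag_paths T E"
    using sets_eq_imp_space_eq[OF sets]
    by (auto simp: path_space_def space_restrict_space space_PiM cadlag_paths_def)
  have coord: "(\<lambda>\<omega>. f (\<omega> t)) \<in> measurable P M"
    if "0 \<le> t" "t \<le> T" "f \<in> space (count_space E) \<rightarrow> space M" for t f and M :: "'b measure"
  proof -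
    have "(\<lambda>\<omega>. f (\<omega> t)) \<in> measurable (Pi\<^sub>M {0..T} (\<lambda>_. count_space E)) M"
      using that by (intro measurable_compose[OF measurable_component_singleton]) auto
    then show ?thesis
      unfolding measurable_cong_sets[OF sets refl] path_space_def by (rule measurable_restrict_space1)
  qed
  have "(LINT \<omega>|P. f (\<omega> t)) = measure_pmf.expectation (bind_pmf \<mu> (K t)) f"
    if t: "0 \<le> t" "t \<le> T" for f :: "'s \<Rightarrow> real" and t
  proof -
    \<comment> \<open>\<open>real_cond_exp\<close> has the properties of a conditional expectation
      only relative to a genuine sub-sigma-algebra of \<open>P\<close>.\<close>
    have sub: "subalgebra P (past T E 0)"
      unfolding subalgebra_def
    proof
      show "space (past T E 0) = space P" by (simp add: past_def space)
      show "sets (past T E 0) \<subseteq> sets P" unfolding past_def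
      proof (rule sets_image_in_sets[OF space])
        have "(\<lambda>\<omega>. restrict \<omega> {0..0}) \<in>
            measurable (Pi\<^sub>M {0..T} (\<lambda>_. count_space E)) (Pi\<^sub>M {0..0} (\<lambda>_. count_space E))"
          using t by (intro measurable_restrict_subset) auto
        then show "(\<lambda>\<omega>. restrict \<omega> {0..0}) \<in> measurable P (Pi\<^sub>M {0..0} (\<lambda>_. count_space E))"
          unfolding measurable_cong_sets[OF sets refl] path_space_def by (rule measurable_restrict_space1)
      qed
    qed
    interpret finite_measure_subalgebra P "past T E 0"
      by unfold_locales (rule sub)
    have meas: "(\<lambda>\<omega>. f (\<omega> t)) \<in> borel_measurable P" by (rule coord) (use t in auto)
    have int: "integrable P (\<lambda>\<omega>. f (\<omega> t))"
    proof (rule integrable_const_bound[OF _ meas])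
      show "AE \<omega> in P. norm (f (\<omega> t)) \<le> Max ((\<lambda>x. norm (f x)) ` E)"
        using t fin by (intro AE_I2) (auto simp: space cadlag_paths_def PiE_iff)
    qed
    define g where "g x = measure_pmf.expectation (K t x) f" for x
    have "(LINT \<omega>|P. f (\<omega> t)) = (LINT \<omega>|P. real_cond_exp P (past T E 0) (\<lambda>\<omega>'. f (\<omega>' t)) \<omega>)"
      using real_cond_exp_int(2)[OF int] by simp
    also have "\<dots> = (LINT \<omega>|P. g (\<omega> 0))"
    proof (rule integral_cong_AE)
      show "(\<lambda>\<omega>. g (\<omega> 0)) \<in> borel_measurable P" by (rule coord) (use t in auto)
      show "AE \<omega> in P. real_cond_exp P (past T E 0) (\<lambda>\<omega>'. f (\<omega>' t)) \<omega> = g (\<omega> 0)"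
        using cond[of 0 t f] t by (simp add: g_def)
    qed simp
    also have "\<dots> = (LINT x|distr P (count_space UNIV) (\<lambda>\<omega>. \<omega> 0). g x)"
      by (subst integral_distr) (use t in \<open>auto intro!: coord[of 0 "\<lambda>x. x"]\<close>)
    also have "\<dots> = measure_pmf.expectation \<mu> g" by (simp add: init)
    also have "\<dots> = measure_pmf.expectation (bind_pmf \<mu> (K t)) f"
      unfolding g_def using \<mu>
      by (intro pmf_expectation_bind_finite[symmetric] finite_set_pmf_semigroup[OF fin K(1) t(1)]
        finite_subset[OF \<mu> fin]) auto
    finally show ?thesis .
  qed
  with K show thesis by (rule that)
qed

section \<open>Second moments and approximation of test functions by cosines\<close>

lemma power2_add_le: "(a + b)\<^sup>2 \<le> 2 * a\<^sup>2 + 2 * b\<^sup>2" for a b :: real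
  using zero_le_power2[of "a - b"] by (simp add: power2_eq_square algebra_simps)

lemma pmf_second_moment_add_le:
  fixes f g h :: "'a \<Rightarrow> real"
  assumes fin: "finite (set_pmf p)" and "\<And>x. x \<in> set_pmf p \<Longrightarrow> \<bar>h x - f x\<bar> \<le> \<bar>g x\<bar>"
  shows "measure_pmf.expectation p (\<lambda>x. (h x)\<^sup>2)
    \<le> 2 * measure_pmf.expectation p (\<lambda>x. (f x)\<^sup>2) + 2 * measure_pmf.expectation p (\<lambda>x. (g x)\<^sup>2)"
proof -
  have "measure_pmf.expectation p (\<lambda>x. (h x)\<^sup>2)
      \<le> measure_pmf.expectation p (\<lambda>x. 2 * (f x)\<^sup>2 + 2 * (g x)\<^sup>2)"
  proof (rule pmf_expectation_mono[OF fin])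
    fix x assume "x \<in> set_pmf p"
    from assms(2)[OF this] have "(h x - f x)\<^sup>2 \<le> (g x)\<^sup>2" by (simp add: abs_le_square_iff)
    moreover have "(h x)\<^sup>2 \<le> 2 * (f x)\<^sup>2 + 2 * (h x - f x)\<^sup>2"
      using power2_add_le[of "f x" "h x - f x"] by simp
    ultimately show "(h x)\<^sup>2 \<le> 2 * (f x)\<^sup>2 + 2 * (g x)\<^sup>2" by linarith
  qed
  also have "\<dots> = 2 * measure_pmf.expectation p (\<lambda>x. (f x)\<^sup>2) + 2 * measure_pmf.expectation p (\<lambda>x. (g x)\<^sup>2)"
    by (simp add: integrable_measure_pmf_finite[OF fin])
  finally show ?thesis .
qed

text \<open>For bounded statistics convergence in probability upgrades to mean square, since the
  square is at most \<open>\<delta>\<^sup>2\<close> plus the indicator of a deviation. It converts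
  the hypothesis \<open>associated\<close> into the form used by the moment bounds.\<close>

lemma second_moment_tendsto_0:
  fixes f :: "nat \<Rightarrow> 'a \<Rightarrow> real" and p :: "nat \<Rightarrow> 'a pmf"
  assumes bnd: "\<forall>\<^sub>F N in sequentially. finite (set_pmf (p N)) \<and> (\<forall>x\<in>set_pmf (p N). \<bar>f N x\<bar> \<le> 1)"
    and lim: "\<And>\<delta>. \<delta> > 0 \<Longrightarrow> (\<lambda>N. measure_pmf.prob (p N) {x. \<bar>f N x\<bar> > \<delta>}) \<longlonglongrightarrow> 0"
  shows "(\<lambda>N. measure_pmf.expectation (p N) (\<lambda>x. (f N x)\<^sup>2)) \<longlonglongrightarrow> 0"
proof (rule tendstoI)
  fix e :: real assume e: "e > 0"
  define \<delta> where "\<delta> = sqrt (e / 2)"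
  have \<delta>: "\<delta> > 0" "\<delta>\<^sup>2 = e / 2" using e by (auto simp: \<delta>_def)
  have "\<forall>\<^sub>F N in sequentially. measure_pmf.prob (p N) {x. \<bar>f N x\<bar> > \<delta>} < e / 2"
    using order_tendstoD(2)[OF lim[OF \<delta>(1)], of "e / 2"] e by simp
  with bnd show "\<forall>\<^sub>F N in sequentially. dist (measure_pmf.expectation (p N) (\<lambda>x. (f N x)\<^sup>2)) 0 < e"
  proof eventually_elim
    case (elim N)
    then have int: "integrable (measure_pmf (p N)) u" for u :: "'a \<Rightarrow> real"
      by (intro integrable_measure_pmf_finite) simp
    have "measure_pmf.expectation (p N) (\<lambda>x. (f N x)\<^sup>2)
        \<le> measure_pmf.expectation (p N) (\<lambda>x. \<delta>\<^sup>2 + indicator {x. \<bar>f N x\<bar> > \<delta>} x)"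
    proof (rule pmf_expectation_mono)
      fix x assume "x \<in> set_pmf (p N)"
      with elim have 1: "\<bar>f N x\<bar> \<le> 1" by auto
      show "(f N x)\<^sup>2 \<le> \<delta>\<^sup>2 + indicator {x. \<bar>f N x\<bar> > \<delta>} x"
      proof (cases "\<bar>f N x\<bar> > \<delta>")
        case True
        moreover have "(f N x)\<^sup>2 \<le> 1" using 1 by (simp add: abs_square_le_1)
        ultimately show ?thesis by (simp add: add_increasing)
      next
        case False
        then show ?thesis using \<delta>(1) by (simp add: abs_le_square_iff[symmetric])
      qed
    qed (use elim in auto)
    also have "\<dots> = \<delta>\<^sup>2 + measure_pmf.prob (p N) {x. \<bar>f N x\<bar> > \<delta>}" using int by simp
    also have "\<dots> < e" using elim \<delta>(2) by simp
    finally have "measure_pmf.expectation (p N) (\<lambda>x. (f N x)\<^sup>2) < e" .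
    moreover have "0 \<le> measure_pmf.expectation (p N) (\<lambda>x. (f N x)\<^sup>2)" by simp
    ultimately show ?case by simp
  qed
qed

text \<open>Only linear operations are constructors, so that convergence passes from modes to all
  elements by an induction with linear steps; closure under products is a derived fact.\<close>

inductive_set cosine_polynomials :: "(real \<Rightarrow> real) set" where
  cos: "(\<lambda>u. cos (real k * pi * u)) \<in> cosine_polynomials"
| scale: "f \<in> cosine_polynomials \<Longrightarrow> (\<lambda>u. c * f u) \<in> cosine_polynomials"
| add: "f \<in> cosine_polynomials \<Longrightarrow> g \<in> cosine_polynomials \<Longrightarrow> (\<lambda>u. f u + g u) \<in> cosine_polynomials"

lemma cosine_polynomials_continuous:
  "f \<in> cosine_polynomials \<Longrightarrow> continuous_on S f"
  by (induction rule: cosine_polynomials.induct) (auto intro!: continuous_intros)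

text \<open>By bilinearity, induction on both factors reduces to two cosines, and there the
  product-to-sum formula applies.\<close>

lemma cosine_polynomials_mult:
  assumes "f \<in> cosine_polynomials" "g \<in> cosine_polynomials"
  shows "(\<lambda>u. f u * g u) \<in> cosine_polynomials"
  using assms
proof (induction arbitrary: g rule: cosine_polynomials.induct)
  case (cos j)
  from cos show ?case
  proof (induction rule: cosine_polynomials.induct)
    case (cos k)
    \<comment> \<open>Frequencies are natural numbers, so the difference is taken in absolute value;
      evenness of cosine justifies this.\<close>
    have *: "cos (real j * pi * u) * cos (real k * pi * u) =
        1 / 2 * (cos (real (if k \<le> j then j - k else k - j) * pi * u) + cos (real (j + k) * pi * u))" for u
    proof -
      have "cos (real (if k \<le> j then j - k else k - j) * pi * u) = cos (real j * pi * u - real k * pi * u)"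
      proof (cases "k \<le> j")
        case False
        have "cos (real (k - j) * pi * u) = cos (- (real (k - j) * pi * u))" by simp
        also have "- (real (k - j) * pi * u) = real j * pi * u - real k * pi * u"
          using False by (simp add: of_nat_diff algebra_simps)
        finally show ?thesis using False by simp
      qed (simp add: of_nat_diff algebra_simps)
      then show ?thesis by (simp add: cos_times_cos algebra_simps)
    qed
    show ?case unfolding * by (intro cosine_polynomials.intros)
  next
    case (scale f c)
    from cosine_polynomials.scale[OF scale.IH, of c] show ?case by (simp add: mult_ac)
  next
    case (add f g)
    from cosine_polynomials.add[OF add.IH] show ?case by (simp add: algebra_simps)
  qed
next
  case (scale f c)
  from cosine_polynomials.scale[OF scale.IH[OF scale.prems], of c] show ?case by (simp add: mult_ac)
next
  case (add f1 f2)
  from cosine_polynomials.add[OF add.IH(1)[OF add.prems] add.IH(2)[OF add.prems]]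
  show ?case by (simp add: algebra_simps)
qed

text \<open>Stone-Weierstrass: frequency 0 gives the constants, and \<open>cos (pi * u)\<close>
  alone separates points because it is injective on the unit interval.\<close>

lemma cosine_polynomials_dense:
  fixes H :: "real \<Rightarrow> real"
  assumes "continuous_on {0..1} H" "e > 0"
  obtains h where "h \<in> cosine_polynomials" "\<And>u. u \<in> {0..1} \<Longrightarrow> \<bar>H u - h u\<bar> < e"
proof -
  interpret function_ring_on cosine_polynomials "{0..1::real}"
  proof
    show "(\<lambda>_. c) \<in> cosine_polynomials" for c :: real
      using cosine_polynomials.scale[OF cosine_polynomials.cos[of 0], of c] by simp
    show "\<exists>f\<in>cosine_polynomials. f x \<noteq> f y" if "x \<in> {0..1}" "y \<in> {0..1}" "x \<noteq> y" for x y :: real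
    proof (rule bexI[OF _ cosine_polynomials.cos[of 1]])
      show "cos (real 1 * pi * x) \<noteq> cos (real 1 * pi * y)"
        using that by (auto dest!: cos_inj_pi[rotated -1] simp: mult_le_cancel_left1)
    qed
  qed (auto intro: cosine_polynomials_continuous cosine_polynomials_mult cosine_polynomials.add)
  show thesis using Stone_Weierstrass_basic[OF assms] that by blast
qed

definition l2_deviation :: "(nat \<Rightarrow> config pmf) \<Rightarrow> real \<Rightarrow> (real \<Rightarrow> real) \<Rightarrow> nat \<Rightarrow> real" where
  "l2_deviation \<nu> m h N = measure_pmf.expectation (\<nu> N)
     (\<lambda>\<eta>. (empirical N \<eta> h - m * (LINT x|lebesgue_on {0..1}. h x))\<^sup>2)"

lemma l2_deviation_nonneg: "0 \<le> l2_deviation \<nu> m h N"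
  by (simp add: l2_deviation_def)

text \<open>The empirical measure and \<open>m\<close> times Lebesgue measure both have mass at most
  1, so each side moves by at most \<open>e\<close>; the constant is 8 = 2 * 2 ^ 2.\<close>

lemma l2_deviation_close:
  assumes supp: "set_pmf (\<nu> N) \<subseteq> configs N" and m: "m \<in> {0..1}"
    and cont: "continuous_on {0..1} H" "continuous_on {0..1} h"
    and close: "\<And>u. u \<in> {0..1} \<Longrightarrow> \<bar>H u - h u\<bar> < e"
  shows "l2_deviation \<nu> m H N \<le> 2 * l2_deviation \<nu> m h N + 8 * e\<^sup>2"
proof -
  have fin: "finite (set_pmf (\<nu> N))" using supp finite_configs by (rule finite_subset)
  have e: "0 < e" using close[of 0] by auto
  note int = continuous_imp_integrable_real[OF cont(1)] continuous_imp_integrable_real[OF cont(2)]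
  have "\<bar>LINT x|lebesgue_on {0..1}. H x - h x\<bar> \<le> (LINT x|lebesgue_on {0..1::real}. \<bar>H x - h x\<bar>)"
    by (rule integral_abs_bound)
  also have "\<dots> \<le> (LINT x|lebesgue_on {0..1::real}. e)"
    using int close by (intro integral_mono) (auto simp: less_imp_le)
  also have "\<dots> = e" by (simp add: measure_restrict_space)
  finally have I: "\<bar>LINT x|lebesgue_on {0..1}. H x - h x\<bar> \<le> e" .
  have "l2_deviation \<nu> m H N
      \<le> 2 * l2_deviation \<nu> m h N + 2 * measure_pmf.expectation (\<nu> N) (\<lambda>_. (2 * e)\<^sup>2)"
    unfolding l2_deviation_def
  proof (rule pmf_second_moment_add_le[OF fin])
    fix \<eta> assume "\<eta> \<in> set_pmf (\<nu> N)"
    with supp have \<eta>: "\<eta> \<in> configs N" by auto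
    have "\<bar>empirical N \<eta> H - empirical N \<eta> h\<bar> \<le> e"
      unfolding empirical_eq_linear_stat linear_stat_diff
      by (rule abs_linear_stat_le[OF \<eta>]) (use e in \<open>auto intro!: less_imp_le[OF close]\<close>)
    moreover have "\<bar>m * (LINT x|lebesgue_on {0..1}. H x - h x)\<bar> \<le> 1 * e"
      unfolding abs_mult using I m by (intro mult_mono) auto
    ultimately have "\<bar>empirical N \<eta> H - empirical N \<eta> h - m * (LINT x|lebesgue_on {0..1}. H x - h x)\<bar> \<le> 2 * e"
      by linarith
    then show "\<bar>empirical N \<eta> H - m * (LINT x|lebesgue_on {0..1}. H x) -
        (empirical N \<eta> h - m * (LINT x|lebesgue_on {0..1}. h x))\<bar> \<le> \<bar>2 * e\<bar>"
      using int e by (simp add: algebra_simps)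
  qed
  then show ?thesis by (simp add: power2_eq_square)
qed

lemma l2_deviation_tendsto_0:
  assumes supp: "\<And>N. N \<ge> 3 \<Longrightarrow> set_pmf (\<nu> N) \<subseteq> configs N" and m: "m \<in> {0..1}"
    and modes: "\<And>k. l2_deviation \<nu> m (\<lambda>u. cos (real k * pi * u)) \<longlonglongrightarrow> 0"
    and H: "continuous_on {0..1} H"
  shows "l2_deviation \<nu> m H \<longlonglongrightarrow> 0"
proof -
  have poly: "l2_deviation \<nu> m h \<longlonglongrightarrow> 0" if "h \<in> cosine_polynomials" for h
    using that
  proof (induction rule: cosine_polynomials.induct)
    case (cos k)
    show ?case by (rule modes)
  next
    case (scale f c)
    have "empirical N \<eta> (\<lambda>u. c * f u) - m * (LINT x|lebesgue_on {0..1}. c * f x) =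
        c * (empirical N \<eta> f - m * (LINT x|lebesgue_on {0..1}. f x))" for N \<eta>
      by (simp add: empirical_def sum_distrib_left algebra_simps)
    then have "l2_deviation \<nu> m (\<lambda>u. c * f u) = (\<lambda>N. c\<^sup>2 * l2_deviation \<nu> m f N)"
      unfolding l2_deviation_def by (simp add: power_mult_distrib)
    then show ?case using tendsto_mult_right_zero[OF scale.IH, of "c\<^sup>2"] by simp
  next
    case (add f g)
    note int = continuous_imp_integrable_real[OF cosine_polynomials_continuous[OF add.hyps(1)]]
      continuous_imp_integrable_real[OF cosine_polynomials_continuous[OF add.hyps(2)]]
    show ?case
    proof (rule Lim_null_comparison)
      show "(\<lambda>N. 2 * l2_deviation \<nu> m f N + 2 * l2_deviation \<nu> m g N) \<longlonglongrightarrow> 0"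
        using add.IH by (auto intro!: tendsto_eq_intros)
      show "\<forall>\<^sub>F N in sequentially. norm (l2_deviation \<nu> m (\<lambda>u. f u + g u) N)
          \<le> 2 * l2_deviation \<nu> m f N + 2 * l2_deviation \<nu> m g N"
        using eventually_ge_at_top[of 3]
      proof eventually_elim
        case (elim N)
        have "l2_deviation \<nu> m (\<lambda>u. f u + g u) N \<le> 2 * l2_deviation \<nu> m f N + 2 * l2_deviation \<nu> m g N"
          unfolding l2_deviation_def
          by (rule pmf_second_moment_add_le[OF finite_subset[OF supp[OF elim] finite_configs]])
            (simp add: empirical_def int sum.distrib add_divide_distrib algebra_simps)
        then show ?case by (simp add: l2_deviation_nonneg)
      qed
    qed
  qed
  show ?thesis
  proof (rule tendstoI)
    fix e :: real assume e: "e > 0"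
    \<comment> \<open>Chosen so that \<open>8 * d\<^sup>2\<close> is half of \<open>e\<close>; the
      other half is \<open>2 * (e / 4)\<close> from the cosine polynomial.\<close>
    define d where "d = sqrt (e / 16)"
    have d: "d > 0" "8 * d\<^sup>2 = e / 2" using e by (auto simp: d_def)
    obtain h where h: "h \<in> cosine_polynomials" "\<And>u. u \<in> {0..1} \<Longrightarrow> \<bar>H u - h u\<bar> < d"
      using cosine_polynomials_dense[OF H d(1)] by blast
    have "\<forall>\<^sub>F N in sequentially. l2_deviation \<nu> m h N < e / 4"
      using order_tendstoD(2)[OF poly[OF h(1)], of "e / 4"] e by simp
    with eventually_ge_at_top[of 3]
    show "\<forall>\<^sub>F N in sequentially. dist (l2_deviation \<nu> m H N) 0 < e"
    proof eventually_elim
      case (elim N)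
      have "l2_deviation \<nu> m H N \<le> 2 * l2_deviation \<nu> m h N + 8 * d\<^sup>2"
        by (rule l2_deviation_close[OF supp m H cosine_polynomials_continuous h(2)]) (use elim h in auto)
      then show ?case using elim d l2_deviation_nonneg[of \<nu> m H N] by simp
    qed
  qed
qed

section \<open>Continuous cosines against discrete modes\<close>

text \<open>The primitive is a multiple of \<open>sin (k * pi * u)\<close>, zero at both ends. Hence
  the predicted limit of a nonconstant mode is 0 whatever the mass is.\<close>

lemma LINT_cos_eq_0:
  assumes "k \<ge> 1"
  shows "(LINT u|lebesgue_on {0..1}. cos (real k * pi * u)) = 0"
proof -
  have "((\<lambda>u. cos (real k * pi * u)) has_integral
      sin (real k * pi * 1) / (real k * pi) - sin (real k * pi * 0) / (real k * pi)) {0..1}"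
    using assms by (intro fundamental_theorem_of_calculus)
      (auto simp: has_real_derivative_iff_has_vector_derivative[symmetric] intro!: derivative_eq_intros)
  then have "integral {0..1} (\<lambda>u. cos (real k * pi * u)) = 0"
    by (intro integral_unique) (simp add: mult.commute)
  then show ?thesis
    by (subst lebesgue_integral_eq_integral) (auto intro!: continuous_imp_integrable_real continuous_intros)
qed

text \<open>The empirical measure samples at \<open>x / N\<close>, the exact eigenvector at
  \<open>(x - 1 / 2) / (N - 1)\<close>; these points differ by at most 1 / (N - 1), and cosine is
  1-Lipschitz.\<close>

lemma cosine_mode_approximation:
  assumes N: "N \<ge> 3" and x: "x \<in> {1..N - 1}"
  shows "\<bar>cos (real k * pi * (real x / real N)) - cosine_mode k N x\<bar> \<le> real k * pi / (real N - 1)"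
proof -
  have x': "1 \<le> real x" "real x \<le> real N" using x by auto
  have "real x / real N - (real x - 1 / 2) / (real N - 1) = (1 / 2 - real x / real N) / (real N - 1)"
    using N by (simp add: divide_simps) (simp add: algebra_simps)
  moreover have "\<bar>1 / 2 - real x / real N\<bar> \<le> 1"
  proof -
    have "0 \<le> real x / real N" "real x / real N \<le> 1" using x' N by auto
    then show ?thesis by linarith
  qed
  ultimately have d: "\<bar>real x / real N - (real x - 1 / 2) / (real N - 1)\<bar> \<le> 1 / (real N - 1)"
    using N by (simp add: abs_divide divide_right_mono)
  have "\<bar>cos (real k * pi * (real x / real N)) - cosine_mode k N x\<bar>
      \<le> \<bar>real k * pi * (real x / real N) - real k * pi / (real N - 1) * (real x - 1 / 2)\<bar>"
    unfolding cosine_mode_def by (rule abs_cos_diff_le)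
  also have "real k * pi * (real x / real N) - real k * pi / (real N - 1) * (real x - 1 / 2) =
      real k * pi * (real x / real N - (real x - 1 / 2) / (real N - 1))"
    by (simp add: algebra_simps)
  also have "\<bar>\<dots>\<bar> \<le> real k * pi * (1 / (real N - 1))"
    unfolding abs_mult using mult_left_mono[OF d, of "real k * pi"] by simp
  finally show ?thesis by simp
qed

section \<open>The limiting differential equation\<close>

text \<open>The integrating factor \<open>exp (2 * t)\<close> makes
  \<open>(m t - \<gamma>) * exp (2 * t)\<close> constant, which gives uniqueness. The explicit
  solution stays in the unit interval as a convex combination of \<open>\<gamma>\<close> and
  \<open>m0\<close>.\<close>

lemma mass_solution_iff:
  assumes T: "T > 0" and \<gamma>: "\<gamma> \<in> {0..1}" and m0: "m0 \<in> {0..1}"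
  shows "mass_solution T \<gamma> m0 m \<longleftrightarrow> m = (\<lambda>t\<in>{0..T}. \<gamma> + exp (- 2 * t) * (m0 - \<gamma>))"
proof
  assume m: "mass_solution T \<gamma> m0 m"
  have "\<exists>c. \<forall>t\<in>{0..T}. (m t - \<gamma>) * exp (2 * t) = c"
  proof (rule has_field_derivative_zero_constant)
    fix t assume "t \<in> {0..T}"
    with m have "(m has_real_derivative - 2 * (m t - \<gamma>)) (at t within {0..T})"
      by (simp add: mass_solution_def)
    then show "((\<lambda>t. (m t - \<gamma>) * exp (2 * t)) has_real_derivative 0) (at t within {0..T})"
      by (auto intro!: derivative_eq_intros simp: algebra_simps)
  qed simp
  then obtain c where c: "\<And>t. t \<in> {0..T} \<Longrightarrow> (m t - \<gamma>) * exp (2 * t) = c" by blast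
  have "m 0 = m0" using m by (simp add: mass_solution_def)
  with c[of 0] T have "c = m0 - \<gamma>" by simp
  show "m = (\<lambda>t\<in>{0..T}. \<gamma> + exp (- 2 * t) * (m0 - \<gamma>))"
  proof
    fix t
    show "m t = (\<lambda>t\<in>{0..T}. \<gamma> + exp (- 2 * t) * (m0 - \<gamma>)) t"
    proof (cases "t \<in> {0..T}")
      case True
      have "m t - \<gamma> = (m t - \<gamma>) * exp (2 * t) * exp (- 2 * t)"
        by (simp add: exp_minus)
      also have "\<dots> = (m0 - \<gamma>) * exp (- 2 * t)"
        unfolding c[OF True] \<open>c = m0 - \<gamma>\<close> ..
      finally show ?thesis using True by (simp add: algebra_simps)
    next
      case False
      then show ?thesis using m by (auto simp: mass_solution_def PiE_def extensional_def)
    qed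
  qed
next
  assume m: "m = (\<lambda>t\<in>{0..T}. \<gamma> + exp (- 2 * t) * (m0 - \<gamma>))"
  have "m t \<in> {0..1}" if "t \<in> {0..T}" for t
  proof -
    have e: "0 < exp (- 2 * t)" "exp (- 2 * t) \<le> 1" using that by auto
    have "m t = (1 - exp (- 2 * t)) * \<gamma> + exp (- 2 * t) * m0"
      using that by (simp add: m algebra_simps)
    also have "\<dots> \<in> {0..1}"
      using convexD[OF convex_real_interval(5), of \<gamma> 0 1 m0 "1 - exp (- 2 * t)" "exp (- 2 * t)"] e \<gamma> m0
      by simp
    finally show ?thesis .
  qed
  then have "m \<in> {0..T} \<rightarrow>\<^sub>E {0..1}" by (auto simp: m)
  moreover have "(m has_real_derivative - 2 * (m t - \<gamma>)) (at t within {0..T})" if "t \<in> {0..T}" for t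
  proof (rule has_field_derivative_transform_within[OF _ zero_less_one that])
    show "((\<lambda>t. \<gamma> + exp (- 2 * t) * (m0 - \<gamma>)) has_real_derivative - 2 * (m t - \<gamma>)) (at t within {0..T})"
      using that by (auto intro!: derivative_eq_intros simp: m)
  qed (simp add: m)
  ultimately show "mass_solution T \<gamma> m0 m" using T by (simp add: mass_solution_def m)
qed


section \<open>Moment bounds averaged over the initial law\<close>

lemma expectation_bind_semigroup_le:
  fixes f g :: "'s \<Rightarrow> real"
  assumes fin: "finite E" and K: "transition_semigroup E K" and \<mu>: "set_pmf \<mu> \<subseteq> E" and t: "0 \<le> t"
    and le: "\<And>x. x \<in> E \<Longrightarrow> measure_pmf.expectation (K t x) f \<le> g x"
  shows "measure_pmf.expectation (bind_pmf \<mu> (K t)) f \<le> measure_pmf.expectation \<mu> g"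
proof -
  have fin\<mu>: "finite (set_pmf \<mu>)" using \<mu> fin by (rule finite_subset)
  have "measure_pmf.expectation (bind_pmf \<mu> (K t)) f =
      measure_pmf.expectation \<mu> (\<lambda>x. measure_pmf.expectation (K t x) f)"
    using \<mu>
    by (intro pmf_expectation_bind_finite fin\<mu> finite_set_pmf_semigroup[OF fin K t]) auto
  also have "\<dots> \<le> measure_pmf.expectation \<mu> g"
    by (intro pmf_expectation_mono fin\<mu> le) (use \<mu> in auto)
  finally show ?thesis .
qed

text \<open>Passing from the corrected to the plain mass costs 1 / N at time 0 and again at time
  \<open>t\<close>, whence the 2 / N in \<open>d\<close>. The initial error is not amplified, as
  \<open>exp (- 2 * t)\<close> is at most 1.\<close>

lemma mass_second_moment:
  assumes N: "N \<ge> 3" and r: "\<alpha> \<in> {0..1}" "\<beta> \<in> {0..1}"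
    and K: "transition_semigroup (configs N) K"
    and gen: "has_generator (configs N) K (accelerated_generator \<alpha> \<beta> N)"
    and t: "0 \<le> t" and \<mu>: "set_pmf \<mu> \<subseteq> configs N" and \<gamma>: "\<gamma> = (\<alpha> + \<beta>) / 2"
  shows "measure_pmf.expectation (bind_pmf \<mu> (K t))
      (\<lambda>\<eta>. (linear_stat N (\<lambda>_. 1) \<eta> - (\<gamma> + exp (- 2 * t) * (m0 - \<gamma>)))\<^sup>2)
    \<le> 60 / real N + 4 * measure_pmf.expectation \<mu> (\<lambda>x. (linear_stat N (\<lambda>_. 1) x - m0)\<^sup>2)"
proof -
  let ?M = "linear_stat N (\<lambda>_. 1)" and ?F = "linear_stat N (corrected_weight N)"
  have "measure_pmf.expectation (bind_pmf \<mu> (K t))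
      (\<lambda>\<eta>. (?M \<eta> - (\<gamma> + exp (- 2 * t) * (m0 - \<gamma>)))\<^sup>2)
    \<le> measure_pmf.expectation \<mu> (\<lambda>x. 60 / real N + 4 * (?M x - m0)\<^sup>2)"
  proof (rule expectation_bind_semigroup_le[OF finite_configs K \<mu> t])
    fix x assume x: "x \<in> configs N"
    have sub: "set_pmf (K t x) \<subseteq> configs N" using K t x by (simp add: transition_semigroup_def)
    define d where "d = 2 / real N + \<bar>?M x - m0\<bar>"
    have "measure_pmf.expectation (K t x) (\<lambda>\<eta>. (?M \<eta> - (\<gamma> + exp (- 2 * t) * (m0 - \<gamma>)))\<^sup>2)
      \<le> 2 * measure_pmf.expectation (K t x) (\<lambda>\<eta>. (?F \<eta> - (\<gamma> + exp (- 2 * t) * (?F x - \<gamma>)))\<^sup>2)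
        + 2 * measure_pmf.expectation (K t x) (\<lambda>_. d\<^sup>2)"
    proof (rule pmf_second_moment_add_le[OF finite_subset[OF sub finite_configs]])
      fix \<eta> assume "\<eta> \<in> set_pmf (K t x)"
      with sub have \<eta>: "\<eta> \<in> configs N" by auto
      have "\<bar>exp (- 2 * t) * (?F x - m0)\<bar> \<le> 1 * \<bar>?F x - m0\<bar>"
        unfolding abs_mult using t by (intro mult_right_mono) auto
      moreover have "\<bar>?F x - m0\<bar> \<le> \<bar>?F x - ?M x\<bar> + \<bar>?M x - m0\<bar>"
        using abs_triangle_ineq[of "?F x - ?M x" "?M x - m0"] by simp
      moreover have "\<bar>?M \<eta> - ?F \<eta> + exp (- 2 * t) * (?F x - m0)\<bar>
          \<le> \<bar>?F \<eta> - ?M \<eta>\<bar> + \<bar>exp (- 2 * t) * (?F x - m0)\<bar>"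
        using abs_triangle_ineq[of "?M \<eta> - ?F \<eta>" "exp (- 2 * t) * (?F x - m0)"]
        unfolding abs_minus_commute[of "?M \<eta>"] .
      moreover have "z \<le> 2 * c + b"
        if "w \<le> 1 * a" "a \<le> v + b" "z \<le> u + w" "u \<le> c" "v \<le> c" for a b c u v w z :: real
        using that by linarith
      ultimately have "\<bar>?M \<eta> - ?F \<eta> + exp (- 2 * t) * (?F x - m0)\<bar> \<le> 2 * (1 / real N) + \<bar>?M x - m0\<bar>"
        using corrected_mass_near_mass[OF N \<eta>] corrected_mass_near_mass[OF N x] by presburger
      then have "\<bar>?M \<eta> - ?F \<eta> + exp (- 2 * t) * (?F x - m0)\<bar> \<le> d"
        unfolding d_def by simp
      moreover have "?M \<eta> - (\<gamma> + exp (- 2 * t) * (m0 - \<gamma>)) - (?F \<eta> - (\<gamma> + exp (- 2 * t) * (?F x - \<gamma>))) =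
          ?M \<eta> - ?F \<eta> + exp (- 2 * t) * (?F x - m0)"
        by (simp add: algebra_simps)
      ultimately show "\<bar>?M \<eta> - (\<gamma> + exp (- 2 * t) * (m0 - \<gamma>)) -
          (?F \<eta> - (\<gamma> + exp (- 2 * t) * (?F x - \<gamma>)))\<bar> \<le> \<bar>d\<bar>"
        by simp
    qed
    also have "\<dots> \<le> 2 * (20 / real N) + 2 * d\<^sup>2"
      using corrected_mass_concentration[OF N r K gen t x \<gamma>] by simp
    \<comment> \<open>The terms of order 1 / N add up to 40 + 8, rounded up to 60.\<close>
    also have "\<dots> \<le> 60 / real N + 4 * (?M x - m0)\<^sup>2"
    proof -
      have "d\<^sup>2 \<le> 2 * (2 / real N)\<^sup>2 + 2 * (?M x - m0)\<^sup>2"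
        unfolding d_def using power2_add_le[of "2 / real N" "\<bar>?M x - m0\<bar>"] by simp
      moreover have "(2 / real N)\<^sup>2 \<le> 2 * (1 / real N)"
        using N by (simp add: power2_eq_square divide_simps)
      moreover have "60 / real N = 60 * (1 / real N)" "20 / real N = 20 * (1 / real N)"
        "0 \<le> 1 / real N" by simp_all
      ultimately show ?thesis by linarith
    qed
    finally show "measure_pmf.expectation (K t x) (\<lambda>\<eta>. (?M \<eta> - (\<gamma> + exp (- 2 * t) * (m0 - \<gamma>)))\<^sup>2)
        \<le> 60 / real N + 4 * (?M x - m0)\<^sup>2" .
  qed
  also have "\<dots> = 60 / real N + 4 * measure_pmf.expectation \<mu> (\<lambda>x. (?M x - m0)\<^sup>2)"
    by (simp add: integrable_measure_pmf_finite[OF finite_subset[OF \<mu> finite_configs]])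
  finally show ?thesis .
qed

text \<open>The decay bound holds from every starting configuration, so averaging over
  \<open>\<mu>\<close> changes nothing: the initial profile is forgotten except for its
  mass.\<close>

lemma cosine_second_moment:
  assumes N: "N \<ge> 3" and r: "\<alpha> \<in> {0..1}" "\<beta> \<in> {0..1}"
    and K: "transition_semigroup (configs N) K"
    and gen: "has_generator (configs N) K (accelerated_generator \<alpha> \<beta> N)"
    and t: "0 \<le> t" and \<mu>: "set_pmf \<mu> \<subseteq> configs N" and rate: "relaxation_rate k N > 0"
  shows "measure_pmf.expectation (bind_pmf \<mu> (K t)) (\<lambda>\<eta>. (empirical N \<eta> (\<lambda>u. cos (real k * pi * u)))\<^sup>2)
    \<le> 2 * ((5 + (real N * (real k * pi / (real N - 1)))\<^sup>2) / (2 * relaxation_rate k N)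
        + exp (- (2 * relaxation_rate k N) * t))
      + 2 * (real k * pi / (real N - 1))\<^sup>2" (is "_ \<le> 2 * ?b + 2 * ?d\<^sup>2")
proof -
  let ?h = "\<lambda>u. cos (real k * pi * u)"
  have "measure_pmf.expectation (bind_pmf \<mu> (K t)) (\<lambda>\<eta>. (empirical N \<eta> ?h)\<^sup>2)
      \<le> measure_pmf.expectation \<mu> (\<lambda>_. 2 * ?b + 2 * ?d\<^sup>2)"
  proof (rule expectation_bind_semigroup_le[OF finite_configs K \<mu> t])
    fix x assume x: "x \<in> configs N"
    have sub: "set_pmf (K t x) \<subseteq> configs N" using K t x by (simp add: transition_semigroup_def)
    have le: "measure_pmf.expectation (K t x) (\<lambda>\<eta>. (empirical N \<eta> ?h)\<^sup>2)
      \<le> 2 * measure_pmf.expectation (K t x) (\<lambda>\<eta>. (linear_stat N (cosine_mode k N) \<eta>)\<^sup>2)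
        + 2 * measure_pmf.expectation (K t x) (\<lambda>_. ?d\<^sup>2)"
    proof (rule pmf_second_moment_add_le[OF finite_subset[OF sub finite_configs]])
      fix \<eta> assume "\<eta> \<in> set_pmf (K t x)"
      with sub have \<eta>: "\<eta> \<in> configs N" by auto
      have "\<bar>empirical N \<eta> ?h - linear_stat N (cosine_mode k N) \<eta>\<bar> \<le> ?d"
        unfolding empirical_eq_linear_stat linear_stat_diff
        by (rule abs_linear_stat_le[OF \<eta> cosine_mode_approximation[OF N]]) (use N in auto)
      then show "\<bar>empirical N \<eta> ?h - linear_stat N (cosine_mode k N) \<eta>\<bar> \<le> \<bar>?d\<bar>" by linarith
    qed
    have const: "measure_pmf.expectation (K t x) (\<lambda>_. ?d\<^sup>2) = ?d\<^sup>2" by simp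
    show "measure_pmf.expectation (K t x) (\<lambda>\<eta>. (empirical N \<eta> ?h)\<^sup>2) \<le> 2 * ?b + 2 * ?d\<^sup>2"
      using order.trans[OF le[unfolded const] add_right_mono[OF mult_left_mono[OF
        cosine_mode_decay[OF N r K gen t x rate]]]] by simp
  qed
  then show ?thesis by simp
qed

text \<open>This is association tested against the constant function 1, with values in the unit
  interval supplying the boundedness.\<close>

lemma initial_mass_second_moment:
  assumes "associated \<mu> \<rho>0" and supp: "\<And>N. N \<ge> 3 \<Longrightarrow> set_pmf (\<mu> N) \<subseteq> configs N"
    and m0: "(LINT x|lebesgue_on {0..1}. \<rho>0 x) \<in> {0..1}"
  shows "(\<lambda>N. measure_pmf.expectation (\<mu> N)
    (\<lambda>x. (linear_stat N (\<lambda>_. 1) x - (LINT x|lebesgue_on {0..1}. \<rho>0 x))\<^sup>2)) \<longlonglongrightarrow> 0"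
proof (rule second_moment_tendsto_0)
  let ?m0 = "LINT x|lebesgue_on {0..1}. \<rho>0 x"
  fix \<delta> :: real assume "\<delta> > 0"
  moreover have "continuous_on {0..1::real} (\<lambda>_. 1 :: real)" by simp
  ultimately have "(\<lambda>N. measure_pmf.prob (\<mu> N)
      {\<eta>. \<bar>empirical N \<eta> (\<lambda>_. 1) - (LINT x|lebesgue_on {0..1}. \<rho>0 x * 1)\<bar> > \<delta>}) \<longlonglongrightarrow> 0"
    using assms(1) unfolding associated_def by blast
  then show "(\<lambda>N. measure_pmf.prob (\<mu> N) {x. \<bar>linear_stat N (\<lambda>_. 1) x - ?m0\<bar> > \<delta>}) \<longlonglongrightarrow> 0"
    by (simp add: empirical_eq_linear_stat)
next
  let ?m0 = "LINT x|lebesgue_on {0..1}. \<rho>0 x"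
  show "\<forall>\<^sub>F N in sequentially. finite (set_pmf (\<mu> N)) \<and>
      (\<forall>x\<in>set_pmf (\<mu> N). \<bar>linear_stat N (\<lambda>_. 1) x - ?m0\<bar> \<le> 1)"
    using eventually_ge_at_top[of 3]
  proof eventually_elim
    case (elim N)
    have "\<bar>linear_stat N (\<lambda>_. 1) x - ?m0\<bar> \<le> 1" if "x \<in> set_pmf (\<mu> N)" for x
    proof -
      have x: "x \<in> configs N" using supp[OF elim] that by auto
      have "\<bar>linear_stat N (\<lambda>_. 1) x\<bar> \<le> 1" by (rule abs_linear_stat_le[OF x]) auto
      with mass_bounds(1)[OF elim x] m0 show ?thesis by (auto simp: abs_le_iff)
    qed
    then show ?case using finite_subset[OF supp[OF elim] finite_configs] by blast
  qed
qed

lemma LINT_unit_interval_bounds: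
  fixes \<rho> :: "real \<Rightarrow> real"
  assumes meas: "\<rho> \<in> borel_measurable (lebesgue_on {0..1})"
    and bnd: "\<And>x. x \<in> {0..1} \<Longrightarrow> \<rho> x \<in> {0..1}"
  shows "(LINT x|lebesgue_on {0..1}. \<rho> x) \<in> {0..1}"
proof -
  interpret finite_measure "lebesgue_on {0..1::real}"
    by (rule finite_measure_lebesgue_on) simp
  have int: "integrable (lebesgue_on {0..1}) \<rho>"
    by (rule integrable_const_bound[OF _ meas, of 1]) (use bnd in \<open>auto intro!: AE_I2\<close>)
  have "0 \<le> (LINT x|lebesgue_on {0..1}. \<rho> x)"
    by (rule Bochner_Integration.integral_nonneg) (use bnd in auto)
  moreover have "(LINT x|lebesgue_on {0..1}. \<rho> x) \<le> (LINT x|lebesgue_on {0..1::real}. 1)"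
    by (rule integral_mono[OF int]) (use bnd in auto)
  ultimately show ?thesis by (simp add: measure_restrict_space)
qed

theorem theorem2p3:
  fixes T \<alpha> \<beta> \<gamma> :: real
    and \<rho>0 :: "real \<Rightarrow> real"
    and \<mu> :: "nat \<Rightarrow> config pmf"
    and P :: "nat \<Rightarrow> (real \<Rightarrow> config) measure"
  assumes "T > 0" "0 < \<alpha>" "\<alpha> < 1" "0 < \<beta>" "\<beta> < 1"
    and "\<gamma> = (\<alpha> + \<beta>) / 2"
    and "\<rho>0 \<in> borel_measurable (lebesgue_on {0..1})"
    and "\<And>x. x \<in> {0..1} \<Longrightarrow> \<rho>0 x \<in> {0..1}"
    and "\<And>N. N \<ge> 3 \<Longrightarrow> set_pmf (\<mu> N) \<subseteq> configs N"
    and "associated \<mu> \<rho>0"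
    and "\<And>N. N \<ge> 3 \<Longrightarrow> markov_law T (configs N) (accelerated_generator \<alpha> \<beta> N) (\<mu> N) (P N)"
  shows "(\<exists>!m. mass_solution T \<gamma> (LINT x|lebesgue_on {0..1}. \<rho>0 x) m) \<and>
    (\<forall>m. mass_solution T \<gamma> (LINT x|lebesgue_on {0..1}. \<rho>0 x) m \<longrightarrow>
      (\<forall>t\<in>{0<..T}. \<forall>\<delta>>0. \<forall>H. continuous_on {0..1} H \<longrightarrow>
        (\<lambda>N. measure (P N) {\<omega> \<in> space (P N).
           \<bar>empirical N (\<omega> t) H - m t * (LINT x|lebesgue_on {0..1}. H x)\<bar> > \<delta>})
        \<longlonglongrightarrow> 0))"
proof -
  define m0 where "m0 = (LINT x|lebesgue_on {0..1}. \<rho>0 x)"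
  have m0: "m0 \<in> {0..1}" unfolding m0_def by (rule LINT_unit_interval_bounds[OF assms(7,8)])
  have \<gamma>01: "\<gamma> \<in> {0..1}" and r: "\<alpha> \<in> {0..1}" "\<beta> \<in> {0..1}" using assms(2-6) by auto
  note sol_iff = mass_solution_iff[OF assms(1) \<gamma>01 m0]
  note supp = assms(9)
  have "\<exists>K. \<forall>N\<ge>3. transition_semigroup (configs N) (K N) \<and>
      has_generator (configs N) (K N) (accelerated_generator \<alpha> \<beta> N) \<and>
      (\<forall>f t. 0 \<le> t \<longrightarrow> t \<le> T \<longrightarrow>
        (LINT \<omega>|P N. f (\<omega> t) :: real) = measure_pmf.expectation (bind_pmf (\<mu> N) (K N t)) f)"
  \<comment> \<open>Each law comes with its own existentially quantified kernel; choice collects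
    them into one sequence.\<close>
  proof (intro choice allI)
    fix N
    show "\<exists>k. N \<ge> 3 \<longrightarrow> transition_semigroup (configs N) k \<and>
      has_generator (configs N) k (accelerated_generator \<alpha> \<beta> N) \<and>
      (\<forall>f t. 0 \<le> t \<longrightarrow> t \<le> T \<longrightarrow>
        (LINT \<omega>|P N. f (\<omega> t) :: real) = measure_pmf.expectation (bind_pmf (\<mu> N) (k t)) f)"
    proof (cases "N \<ge> 3")
      case True
      from markov_law_marginal[OF assms(11)[OF True] finite_configs supp[OF True]]
      show ?thesis by metis
    qed simp
  qed
  then obtain K where K: "\<And>N. N \<ge> 3 \<Longrightarrow> transition_semigroup (configs N) (K N)"
    and gen: "\<And>N. N \<ge> 3 \<Longrightarrow> has_generator (configs N) (K N) (accelerated_generator \<alpha> \<beta> N)"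
    and marginal: "\<And>N f t. N \<ge> 3 \<Longrightarrow> 0 \<le> t \<Longrightarrow> t \<le> T \<Longrightarrow>
      (LINT \<omega>|P N. f (\<omega> t) :: real) = measure_pmf.expectation (bind_pmf (\<mu> N) (K N t)) f"
    by blast
  have conv: "(\<lambda>N. measure (P N) {\<omega> \<in> space (P N).
           \<bar>empirical N (\<omega> t) H - m t * (LINT x|lebesgue_on {0..1}. H x)\<bar> > \<delta>}) \<longlonglongrightarrow> 0"
    if sol: "mass_solution T \<gamma> m0 m" and t: "t \<in> {0<..T}" and \<delta>: "\<delta> > 0"
      and H: "continuous_on {0..1} H" for m t \<delta> H
  proof -
    define \<nu> where "\<nu> N = bind_pmf (\<mu> N) (K N t)" for N
    have mt: "m t = \<gamma> + exp (- 2 * t) * (m0 - \<gamma>)" using sol t unfolding sol_iff by simp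
    have m01: "m t \<in> {0..1}" using sol t by (auto simp: mass_solution_def PiE_iff)
    have \<nu>: "set_pmf (\<nu> N) \<subseteq> configs N" if "N \<ge> 3" for N
    proof -
      have "set_pmf (K N t x) \<subseteq> configs N" if "x \<in> configs N" for x
        using K[OF \<open>N \<ge> 3\<close>] that t by (simp add: transition_semigroup_def)
      then show ?thesis using supp[OF that] unfolding \<nu>_def set_bind_pmf by blast
    qed
    have modes: "l2_deviation \<nu> (m t) (\<lambda>u. cos (real k * pi * u)) \<longlonglongrightarrow> 0" for k
    \<comment> \<open>Mode 0 is the mass and carries the whole limit; for every other mode the
      target integral is 0 and relaxation alone suffices.\<close>
    proof (cases "k = 0")
      case True
      have eq: "l2_deviation \<nu> (m t) (\<lambda>u. cos (real k * pi * u)) N =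
          measure_pmf.expectation (\<nu> N) (\<lambda>\<eta>. (linear_stat N (\<lambda>_. 1) \<eta> - m t)\<^sup>2)" for N
        by (simp add: True l2_deviation_def empirical_eq_linear_stat measure_restrict_space)
      show ?thesis
      proof (rule Lim_null_comparison)
        show "(\<lambda>N. 60 / real N + 4 * measure_pmf.expectation (\<mu> N)
            (\<lambda>x. (linear_stat N (\<lambda>_. 1) x - m0)\<^sup>2)) \<longlonglongrightarrow> 0"
          using initial_mass_second_moment[OF assms(10) supp, folded m0_def] m0
          by (auto intro!: tendsto_eq_intros lim_const_over_n)
        show "\<forall>\<^sub>F N in sequentially. norm (l2_deviation \<nu> (m t) (\<lambda>u. cos (real k * pi * u)) N)
            \<le> 60 / real N + 4 * measure_pmf.expectation (\<mu> N) (\<lambda>x. (linear_stat N (\<lambda>_. 1) x - m0)\<^sup>2)"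
          using eventually_ge_at_top[of 3]
        proof eventually_elim
          case (elim N)
          from mass_second_moment[OF elim r K[OF elim] gen[OF elim] _ supp[OF elim] assms(6), of t m0] t
          show ?case unfolding eq unfolding mt \<nu>_def by simp
        qed
      qed
    next
      case False
      have eq: "l2_deviation \<nu> (m t) (\<lambda>u. cos (real k * pi * u)) N =
          measure_pmf.expectation (\<nu> N) (\<lambda>\<eta>. (empirical N \<eta> (\<lambda>u. cos (real k * pi * u)))\<^sup>2)" for N
        using False by (simp add: l2_deviation_def LINT_cos_eq_0)
      have k: "real k > 0" and t0: "t > 0" using False t by auto
      show ?thesis
      proof (rule Lim_null_comparison)
        show "(\<lambda>N. 2 * ((5 + (real N * (real k * pi / (real N - 1)))\<^sup>2) / (2 * relaxation_rate k N)
            + exp (- (2 * relaxation_rate k N) * t)) + 2 * (real k * pi / (real N - 1))\<^sup>2) \<longlonglongrightarrow> 0"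
          unfolding relaxation_rate_def using k t0 by real_asymp
        \<comment> \<open>Positivity holds only eventually: the rate vanishes when k is a multiple
          of \<open>2 * (N - 1)\<close>.\<close>
        have "\<forall>\<^sub>F N in sequentially. relaxation_rate k N > 0"
          using relaxation_rate_at_top[of k] False by (simp add: filterlim_at_top_dense)
        then show "\<forall>\<^sub>F N in sequentially. norm (l2_deviation \<nu> (m t) (\<lambda>u. cos (real k * pi * u)) N)
            \<le> 2 * ((5 + (real N * (real k * pi / (real N - 1)))\<^sup>2) / (2 * relaxation_rate k N)
              + exp (- (2 * relaxation_rate k N) * t)) + 2 * (real k * pi / (real N - 1))\<^sup>2"
          using eventually_ge_at_top[of 3]
        proof eventually_elim
          case (elim N)
          from cosine_second_moment[OF elim(2) r K gen _ supp elim(1), OF elim(2) elim(2) _ elim(2), of t] t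
          show ?case unfolding eq unfolding \<nu>_def by simp
        qed
      qed
    qed
    have l2: "l2_deviation \<nu> (m t) H \<longlonglongrightarrow> 0"
      by (rule l2_deviation_tendsto_0[OF \<nu> m01 modes H])
    define S where "S N = {\<eta>. \<bar>empirical N \<eta> H - m t * (LINT x|lebesgue_on {0..1}. H x)\<bar> > \<delta>}" for N
    show ?thesis
    proof (rule Lim_null_comparison)
      show "(\<lambda>N. l2_deviation \<nu> (m t) H N / \<delta>\<^sup>2) \<longlonglongrightarrow> 0"
        using tendsto_divide[OF l2 tendsto_const, of "\<delta>\<^sup>2"] \<delta> by simp
      show "\<forall>\<^sub>F N in sequentially. norm (measure (P N) {\<omega> \<in> space (P N).
           \<bar>empirical N (\<omega> t) H - m t * (LINT x|lebesgue_on {0..1}. H x)\<bar> > \<delta>})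
          \<le> l2_deviation \<nu> (m t) H N / \<delta>\<^sup>2"
        using eventually_ge_at_top[of 3]
      proof eventually_elim
        case (elim N)
        have fin: "finite (set_pmf (\<nu> N))" using \<nu>[OF elim] finite_configs by (rule finite_subset)
        have "measure (P N) {\<omega> \<in> space (P N).
            \<bar>empirical N (\<omega> t) H - m t * (LINT x|lebesgue_on {0..1}. H x)\<bar> > \<delta>} =
            measure (P N) ({\<omega>. \<omega> t \<in> S N} \<inter> space (P N))"
          by (rule arg_cong[of _ _ "measure (P N)"]) (auto simp: S_def)
        also have "\<dots> = (LINT \<omega>|P N. indicator {\<omega>. \<omega> t \<in> S N} \<omega>)" by simp
        also have "\<dots> = (LINT \<omega>|P N. indicator (S N) (\<omega> t))"
          by (simp add: indicator_def)
        also have "\<dots> = measure_pmf.expectation (\<nu> N) (indicator (S N))"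
          unfolding \<nu>_def using t by (intro marginal[OF elim]) auto
        \<comment> \<open>Chebyshev's inequality, checked pointwise: on \<open>S N\<close> the
          quotient of squares is at least 1.\<close>
        also have "\<dots> \<le> measure_pmf.expectation (\<nu> N)
            (\<lambda>\<eta>. (empirical N \<eta> H - m t * (LINT x|lebesgue_on {0..1}. H x))\<^sup>2 / \<delta>\<^sup>2)"
        proof (rule pmf_expectation_mono[OF fin])
          fix \<eta>
          show "indicator (S N) \<eta> \<le> (empirical N \<eta> H - m t * (LINT x|lebesgue_on {0..1}. H x))\<^sup>2 / \<delta>\<^sup>2"
          proof (cases "\<eta> \<in> S N")
            case True
            then have "\<bar>\<delta>\<bar> \<le> \<bar>empirical N \<eta> H - m t * (LINT x|lebesgue_on {0..1}. H x)\<bar>"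
              using \<delta> by (simp add: S_def)
            then show ?thesis using True \<delta> unfolding abs_le_square_iff by simp
          qed simp
        qed
        also have "\<dots> = l2_deviation \<nu> (m t) H N / \<delta>\<^sup>2" by (simp add: l2_deviation_def)
        finally show ?case by simp
      qed
    qed
  qed
  show ?thesis
    unfolding m0_def[symmetric] using conv by (auto simp: sol_iff)
qed

end
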